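(* Let $p$ be a prime and let $M$ be a harmonic matroid. For each embedding of $L_p$ in $M$, the harmonic closure $h^\infty(L_p)$ in $M$ is a Desarguesian projective plane of order $p$ in $M$.
   Context: Matroids may have an infinite ground set; $\operatorname{cl}$ and $\operatorname{r}$ denote closure and rank. Matroids are taken to be simple, so that "point" means element (for lattice-type examples, a rank-one flat); a set of points is collinear if it has rank at most $2$. For elements $y,x,z,o,q,r,s$ of a matroid $M$, $\mathrm{HP}(y,x,z;o,q,r,s)$ means that these are seven distinct elements and the restriction $M|\{y,x,z,o,q,r,s\}$ is a rank-3 matroid whose three-point lines are $\{y,x,z\},\{y,o,q\},\{y,r,s\},\{x,q,s\},\{z,o,s\},\{z,q,r\}$ and possibly also $\{x,o,r\}$, and no other set of three elements is collinear (so it is the non-Fano matroid $F_7^-$, or the Fano matroid $F_7$ if $\{x,o,r\}$ is collinear). For elements $y,x,z$ of $M$, a point $x'$ is a harmonic conjugate of $x$ with respect to $y$ and $z$, written $\mathrm{H}(y,z;x,x')$, if there are elements $o,q,r,s$ with $\mathrm{HP}(y,x,z;o,q,r,s)$ and $\operatorname{cl}(\{y,z\})\cap\operatorname{cl}(\{o,r\})=\{x'\}$. A harmonic matroid is a matroid such that every $\{y,x,z,o,q,r,s\}$ with $\mathrm{HP}(y,x,z;o,q,r,s)$ gives rise to such a harmonic conjugate $x'$, and $x'$ depends only on $x,y,z$ and not on the choice of $o,q,r,s$. For a subset $S$ of the ground set of a harmonic matroid $M$: $h(S)=S\cup\{x\in M: \mathrm{H}(a,c;b,x)\text{ for some }a,b,c\in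 S\}$, $h^n(S)=h(h^{n-1}(S))$ with $h^0(S)=S$, and the harmonic closure of $S$ is $h^\infty(S)=\bigcup_{n\ge 0}h^n(S)$. $L_p$ is the restriction of the projective plane $PG(2,p)$ over $\mathbb Z_p$ (points in homogeneous coordinates $[x,y,z]$) to the set $\{[0,i,1],[1,i,1],[1,i,0]: i\in\mathbb Z_p\}\cup\{[0,1,0]\}$ (three concurrent lines). Its lines with at least three points are $\{[0,i,1]:i\in\mathbb Z_p\}\cup\{[0,1,0]\}$, $\{[1,i,1]:i\in\mathbb Z_p\}\cup\{[0,1,0]\}$, $\{[1,i,0]:i\in\mathbb Z_p\}\cup\{[0,1,0]\}$, and $\{[0,i,1],[1,i+j,1],[1,j,0]\}$ for $i,j\in\mathbb Z_p$. An embedding of a matroid $N$ in $M$ is an injective map of the ground set of $N$ into that of $M$ under which a set is independent in $N$ iff its image is independent in $M$; $N$ is then identified with its image. A set $S$ of points "is a projective plane in $M$" means that $S$, with the lines of the restriction $M|S$, is a projective plane. *)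

theory Defs
  imports
    Complex_Main
    "HOL-Computational_Algebra.Primes"
    "HOL-Library.Extended_Nat"
    "HOL-Number_Theory.Cong"
begin

section \<open>Matroids on possibly infinite ground sets\<close>

record 'a matroid_struct =
  ground :: "'a set"
  indep :: "'a set \<Rightarrow> bool"

text \<open>The last conjunct (finitariness) is automatic for finite ground sets and for finite rank.\<close>

definition matroid :: "'a matroid_struct \<Rightarrow> bool" where
  "matroid M \<longleftrightarrow>
     (\<forall>X. indep M X \<longrightarrow> X \<subseteq> ground M) \<and>
     indep M {} \<and>
     (\<forall>X Y. indep M Y \<longrightarrow> X \<subseteq> Y \<longrightarrow> indep M X) \<and>
     (\<forall>X Y. indep M X \<longrightarrow> indep M Y \<longrightarrow> finite X \<longrightarrow> finite Y \<longrightarrow> card X < card Y \<longrightarrow>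
        (\<exists>e\<in>Y - X. indep M (insert e X))) \<and>
     (\<forall>X. X \<subseteq> ground M \<longrightarrow> (\<forall>Y. Y \<subseteq> X \<longrightarrow> finite Y \<longrightarrow> indep M Y) \<longrightarrow> indep M X)"

definition simple_matroid :: "'a matroid_struct \<Rightarrow> bool" where
  "simple_matroid M \<longleftrightarrow> matroid M \<and> (\<forall>a\<in>ground M. \<forall>b\<in>ground M. indep M {a, b})"

definition rank :: "'a matroid_struct \<Rightarrow> 'a set \<Rightarrow> enat" where
  "rank M X = (SUP I\<in>{I. I \<subseteq> X \<and> finite I \<and> indep M I}. enat (card I))"

definition cl :: "'a matroid_struct \<Rightarrow> 'a set \<Rightarrow> 'a set" where
  "cl M X = {e \<in> ground M. e \<in> X \<or> (\<exists>I. I \<subseteq> X \<and> indep M I \<and> \<not> indep M (insert e I))}"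

definition collinear :: "'a matroid_struct \<Rightarrow> 'a set \<Rightarrow> bool" where
  "collinear M X \<longleftrightarrow> X \<subseteq> ground M \<and> rank M X \<le> 2"

definition restriction :: "'a matroid_struct \<Rightarrow> 'a set \<Rightarrow> 'a matroid_struct" where
  "restriction M S = \<lparr>ground = ground M \<inter> S, indep = (\<lambda>X. indep M X \<and> X \<subseteq> S)\<rparr>"

definition lines :: "'a matroid_struct \<Rightarrow> 'a set set" where
  "lines M = {L. L \<subseteq> ground M \<and> cl M L = L \<and> rank M L = 2}"

definition embedding :: "'b matroid_struct \<Rightarrow> 'a matroid_struct \<Rightarrow> ('b \<Rightarrow> 'a) \<Rightarrow> bool" where
  "embedding N M f \<longleftrightarrow>
     inj_on f (ground N) \<and> f ` ground N \<subseteq> ground M \<and>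
     (\<forall>X. X \<subseteq> ground N \<longrightarrow> (indep N X \<longleftrightarrow> indep M (f ` X)))"


section \<open>Harmonic matroids\<close>

text \<open>\<open>o\<close> is reserved for function composition, hence \<open>o'\<close>.\<close>

definition HP :: "'a matroid_struct \<Rightarrow> 'a \<Rightarrow> 'a \<Rightarrow> 'a \<Rightarrow> 'a \<Rightarrow> 'a \<Rightarrow> 'a \<Rightarrow> 'a \<Rightarrow> bool" where
  "HP M y x z o' q r s \<longleftrightarrow>
     (let S = {y, x, z, o', q, r, s};
          N = restriction M S;
          \<Lambda> = {{y, x, z}, {y, o', q}, {y, r, s}, {x, q, s}, {z, o', s}, {z, q, r}};
          T = {L \<in> lines N. card L = 3}
      in distinct [y, x, z, o', q, r, s] \<and> S \<subseteq> ground M \<and>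
         rank N (ground N) = 3 \<and>
         (T = \<Lambda> \<or> T = insert {x, o', r} \<Lambda>) \<and>
         (\<forall>A. A \<subseteq> S \<longrightarrow> card A = 3 \<longrightarrow> collinear N A \<longrightarrow> A \<in> T))"

text \<open>The argument order is that of \<open>H(y, z; x, x')\<close>.\<close>

definition harmonic_conj :: "'a matroid_struct \<Rightarrow> 'a \<Rightarrow> 'a \<Rightarrow> 'a \<Rightarrow> 'a \<Rightarrow> bool" where
  "harmonic_conj M y z x x' \<longleftrightarrow>
     (\<exists>o' q r s. HP M y x z o' q r s \<and> cl M {y, z} \<inter> cl M {o', r} = {x'})"

definition harmonic_matroid :: "'a matroid_struct \<Rightarrow> bool" where
  "harmonic_matroid M \<longleftrightarrow>
     simple_matroid M \<and>
     (\<forall>y x z o' q r s. HP M y x z o' q r s \<longrightarrow> (\<exists>x'. cl M {y, z} \<inter> cl M {o', r} = {x'})) \<and>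
     (\<forall>y x z x' x''. harmonic_conj M y z x x' \<longrightarrow> harmonic_conj M y z x x'' \<longrightarrow> x' = x'')"

definition harm :: "'a matroid_struct \<Rightarrow> 'a set \<Rightarrow> 'a set" where
  "harm M S = S \<union> {x \<in> ground M. \<exists>a\<in>S. \<exists>b\<in>S. \<exists>c\<in>S. harmonic_conj M a c b x}"

definition harmonic_closure :: "'a matroid_struct \<Rightarrow> 'a set \<Rightarrow> 'a set" where
  "harmonic_closure M S = (\<Union>n. (harm M ^^ n) S)"


section \<open>The matroid \<open>L\<^sub>p\<close>\<close>

text \<open>
  Residues modulo \<open>p\<close> are represented by integers in \<open>{0..<p}\<close>. The point with homogeneous
  coordinates \<open>[a, b, c]\<close> is the one-dimensional subspace of the space of residue triples
  generated by \<open>(a, b, c)\<close>, with the zero vector included.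
\<close>

definition hom_point :: "nat \<Rightarrow> int \<Rightarrow> int \<Rightarrow> int \<Rightarrow> (int \<times> int \<times> int) set" where
  "hom_point p a b c = {((t * a) mod int p, (t * b) mod int p, (t * c) mod int p) | t. True}"

text \<open>
  A set of points is independent iff their representing vectors are linearly independent,
  i.e. iff the sum of these one-dimensional subspaces is direct. All sets of points are finite.
\<close>

definition PG2 :: "nat \<Rightarrow> (int \<times> int \<times> int) set matroid_struct" where
  "PG2 p =
     (let Pts = {hom_point p a b c | a b c. \<not> (int p dvd a \<and> int p dvd b \<and> int p dvd c)}
      in \<lparr>ground = Pts,
          indep = (\<lambda>X. X \<subseteq> Pts \<and>
            (\<forall>v. (\<forall>P\<in>X. v P \<in> P) \<longrightarrow>
               [(\<Sum>P\<in>X. fst (v P)) = 0] (mod int p) \<longrightarrow>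
               [(\<Sum>P\<in>X. fst (snd (v P))) = 0] (mod int p) \<longrightarrow>
               [(\<Sum>P\<in>X. snd (snd (v P))) = 0] (mod int p) \<longrightarrow>
               (\<forall>P\<in>X. v P = (0, 0, 0))))\<rparr>)"

definition L_matroid :: "nat \<Rightarrow> (int \<times> int \<times> int) set matroid_struct" where
  "L_matroid p = restriction (PG2 p)
     ({hom_point p 0 i 1 | i. i \<in> {0..<int p}} \<union>
      {hom_point p 1 i 1 | i. i \<in> {0..<int p}} \<union>
      {hom_point p 1 i 0 | i. i \<in> {0..<int p}} \<union>
      {hom_point p 0 1 0})"


section \<open>Projective planes\<close>

text \<open>A plane is given by its set of points and its set of lines, each line a set of points.\<close>

definition projective_plane :: "'a set \<Rightarrow> 'a set set \<Rightarrow> bool" where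
  "projective_plane P \<L> \<longleftrightarrow>
     (\<forall>L\<in>\<L>. L \<subseteq> P) \<and>
     (\<forall>a\<in>P. \<forall>b\<in>P. a \<noteq> b \<longrightarrow> (\<exists>!L. L \<in> \<L> \<and> a \<in> L \<and> b \<in> L)) \<and>
     (\<forall>L\<in>\<L>. \<forall>L'\<in>\<L>. L \<noteq> L' \<longrightarrow> (\<exists>!a. a \<in> L \<and> a \<in> L')) \<and>
     (\<exists>Q. Q \<subseteq> P \<and> card Q = 4 \<and> (\<forall>L\<in>\<L>. card (Q \<inter> L) \<le> 2))"

definition has_order :: "'a set set \<Rightarrow> nat \<Rightarrow> bool" where
  "has_order \<L> n \<longleftrightarrow> (\<forall>L\<in>\<L>. finite L \<and> card L = n + 1)"

definition on_line :: "'a set set \<Rightarrow> 'a set \<Rightarrow> bool" where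
  "on_line \<L> A \<longleftrightarrow> (\<exists>L\<in>\<L>. A \<subseteq> L)"

text \<open>
  Desargues' theorem: triangles \<open>a\<^sub>1 a\<^sub>2 a\<^sub>3\<close> and \<open>b\<^sub>1 b\<^sub>2 b\<^sub>3\<close> in perspective from a point \<open>u\<close> are in
  perspective from a line. The hypotheses force corresponding sides to be distinct, so
  \<open>c\<^sub>i\<^sub>j\<close> is the intersection point of the lines \<open>a\<^sub>i a\<^sub>j\<close> and \<open>b\<^sub>i b\<^sub>j\<close>.
\<close>

definition desarguesian :: "'a set \<Rightarrow> 'a set set \<Rightarrow> bool" where
  "desarguesian P \<L> \<longleftrightarrow>
     (\<forall>u\<in>P. \<forall>a1\<in>P. \<forall>a2\<in>P. \<forall>a3\<in>P. \<forall>b1\<in>P. \<forall>b2\<in>P. \<forall>b3\<in>P. \<forall>c12\<in>P. \<forall>c13\<in>P. \<forall>c23\<in>P.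
        u \<notin> {a1, a2, a3, b1, b2, b3} \<and> a1 \<noteq> b1 \<and> a2 \<noteq> b2 \<and> a3 \<noteq> b3 \<and>
        on_line \<L> {u, a1, b1} \<and> on_line \<L> {u, a2, b2} \<and> on_line \<L> {u, a3, b3} \<and>
        \<not> on_line \<L> {u, a1, a2} \<and> \<not> on_line \<L> {u, a1, a3} \<and> \<not> on_line \<L> {u, a2, a3} \<and>
        \<not> on_line \<L> {a1, a2, a3} \<and> \<not> on_line \<L> {b1, b2, b3} \<and>
        on_line \<L> {a1, a2, c12} \<and> on_line \<L> {b1, b2, c12} \<and>
        on_line \<L> {a1, a3, c13} \<and> on_line \<L> {b1, b3, c13} \<and>
        on_line \<L> {a2, a3, c23} \<and> on_line \<L> {b2, b3, c23}
        \<longrightarrow> on_line \<L> {c12, c13, c23})"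

definition desarguesian_plane_in :: "'a matroid_struct \<Rightarrow> 'a set \<Rightarrow> nat \<Rightarrow> bool" where
  "desarguesian_plane_in M S n \<longleftrightarrow>
     S \<subseteq> ground M \<and>
     projective_plane S (lines (restriction M S)) \<and>
     has_order (lines (restriction M S)) n \<and>
     desarguesian S (lines (restriction M S))"

end

theory Submission
  imports Defs
begin

text \<open>
  The points of \<open>L\<^sub>p\<close> are those of the vertical lines \<open>x = 0\<close> and \<open>x = 1\<close> and the line at infinity
  of a plane with affine coordinates modulo \<open>p\<close>; these three lines meet in a point \<open>c\<close>, and every
  line of slope \<open>j\<close> meets them in three points. The harmonic conjugate of \<open>(0, k)\<close> with respect to
  \<open>(1, k)\<close> and the point at infinity of slope \<open>0\<close> has to be \<open>(2, k)\<close>. The quadrangles available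
  inside \<open>L\<^sub>p\<close> show that it does lie on the line of every slope \<open>j\<close> through \<open>(1, k - j)\<close>, because
  for \<open>j\<close> nonzero each of these lines is the diagonal of some quadrangle and the conjugate does
  not depend on the quadrangle (\<open>net_fourth_point\<close>). A second type of quadrangle, with \<open>c\<close> as a
  vertex, shows that the new points are collinear with \<open>c\<close>. So the lines \<open>x = 1\<close>, \<open>x = 2\<close> and the
  line at infinity again carry a copy of \<open>L\<^sub>p\<close> (\<open>net_next\<close>), and the construction can be repeated.

  The line of slope \<open>j\<close> through \<open>(0, i)\<close> contains the points \<open>(n, i + j n)\<close> of all lines \<open>x = n\<close>, so the
  first \<open>p\<close> of these lines together with the line at infinity carry all collinearities of
  the projective plane over the integers modulo \<open>p\<close> (\<open>net_coordinates\<close>). There are no others, since a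
  single additional collinearity would put the whole plane on one line (\<open>not_col_pt\<close>).
  The resulting set is closed under harmonic conjugation: three points of one of its
  lines have a quadrangle within the set (\<open>fourth_harmonic\<close>), and any other quadrangle in the
  matroid yields the same conjugate. Hence it is the harmonic closure of \<open>L\<^sub>p\<close>. That it is a
  Desarguesian projective plane of order \<open>p\<close> is linear algebra modulo \<open>p\<close>, carried out with integer
  triples and determinants.

  Throughout, the matroid is seen as a linear space of points with a ternary collinearity relation;
  \<open>quad_HP\<close> is the translation of the configuration \<open>HP\<close> into this language.
\<close>

section \<open>Collinear triples in a simple matroid\<close>

text \<open>
  Triples with repeated points count as collinear, so that the incidence laws of lines need
  not assume three points to be distinct.
\<close>

definition collinear3 :: "'a matroid_struct \<Rightarrow> 'a \<Rightarrow> 'a \<Rightarrow> 'a \<Rightarrow> bool" where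
  "collinear3 M a b c \<longleftrightarrow> {a, b, c} \<subseteq> ground M \<and> \<not> (distinct [a, b, c] \<and> indep M {a, b, c})"

lemma indep_subset: "matroid M \<Longrightarrow> indep M Y \<Longrightarrow> X \<subseteq> Y \<Longrightarrow> indep M X"
  unfolding matroid_def by (drule conjunct2, drule conjunct2, drule conjunct1) blast

lemma indep_ground: "matroid M \<Longrightarrow> indep M X \<Longrightarrow> X \<subseteq> ground M"
  unfolding matroid_def by (drule conjunct1) blast

lemma indep_augment:
  assumes "matroid M" "indep M X" "indep M Y" "finite X" "finite Y" "card X < card Y"
  obtains e where "e \<in> Y - X" "indep M (insert e X)"
  using assms(1)[unfolded matroid_def, THEN conjunct2, THEN conjunct2, THEN conjunct2, THEN conjunct1,
      rule_format, OF assms(2-6)] by blast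

lemma indep_finitary:
  assumes "matroid M" "X \<subseteq> ground M" "\<And>Y. Y \<subseteq> X \<Longrightarrow> finite Y \<Longrightarrow> indep M Y"
  shows "indep M X"
  using assms(1)[unfolded matroid_def, THEN conjunct2, THEN conjunct2, THEN conjunct2, THEN conjunct2,
      rule_format, OF assms(2)] assms(3) by blast

lemma simple_matroidD: "simple_matroid M \<Longrightarrow> matroid M"
  unfolding simple_matroid_def by blast

lemma indep_pair: "simple_matroid M \<Longrightarrow> a \<in> ground M \<Longrightarrow> b \<in> ground M \<Longrightarrow> indep M {a, b}"
  unfolding simple_matroid_def by blast

lemma collinear3_ground: "collinear3 M a b c \<Longrightarrow> a \<in> ground M \<and> b \<in> ground M \<and> c \<in> ground M"
  unfolding collinear3_def by blast

lemma collinear3_swap12: "collinear3 M a b c \<Longrightarrow> collinear3 M b a c"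
  unfolding collinear3_def by (auto simp: insert_commute)

lemma collinear3_swap23: "collinear3 M a b c \<Longrightarrow> collinear3 M a c b"
  unfolding collinear3_def by (auto simp: insert_commute)

lemma collinear3_degenerate: "a \<in> ground M \<Longrightarrow> b \<in> ground M \<Longrightarrow> collinear3 M a a b"
  unfolding collinear3_def by auto

lemma collinear3_trans:
  assumes M: "simple_matroid M" and "a \<noteq> b" and abc: "collinear3 M a b c" and abd: "collinear3 M a b d"
  shows "collinear3 M a c d"
proof (rule ccontr)
  assume "\<not> collinear3 M a c d"
  with abc abd have d: "distinct [a, c, d]" and i: "indep M {a, c, d}"
    unfolding collinear3_def by auto
  have "indep M {a, b}"
    using M abc by (auto intro: indep_pair simp: collinear3_def)
  then obtain e where "e \<in> {a, c, d} - {a, b}" "indep M (insert e {a, b})"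
    by (rule indep_augment[OF simple_matroidD[OF M] _ i]) (use d \<open>a \<noteq> b\<close> in auto)
  then show False
    using abc abd \<open>a \<noteq> b\<close> unfolding collinear3_def by (auto simp: insert_commute)
qed

lemma collinear3_on_line:
  assumes "simple_matroid M" "a \<noteq> b" "collinear3 M a b c" "collinear3 M a b d" "collinear3 M a b e"
  shows "collinear3 M c d e"
proof (cases "c = a")
  case True
  then show ?thesis using collinear3_trans assms by metis
next
  case False
  have "collinear3 M c a d" "collinear3 M c a e"
    using collinear3_trans[OF assms(1,2)] assms(3-5) collinear3_swap12 by metis+
  then show ?thesis
    using collinear3_trans[OF assms(1) False] by blast
qed

text \<open>
  Three points of an independent set inside a line would be a collinear independent triple.
  Infinite independent sets are covered as well, since they contain such triples too.
\<close>

lemma indep_in_line: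
  assumes M: "simple_matroid M" and "a \<noteq> b" and I: "indep M I" "I \<subseteq> {c. collinear3 M a b c}"
  shows "finite I \<and> card I \<le> 2"
proof (rule ccontr)
  assume "\<not> (finite I \<and> card I \<le> 2)"
  then obtain J where J: "J \<subseteq> I" "card J = 3"
    by (metis One_nat_def Suc_1 infinite_arbitrarily_large not_less_eq_eq
        numeral_3_eq_3 obtain_subset_with_card_n)
  then obtain u v w where uvw: "J = {u, v, w}" "distinct [u, v, w]"
    by (auto simp: card_3_iff)
  have "collinear3 M u v w"
    using collinear3_on_line[OF M \<open>a \<noteq> b\<close>] J(1) I(2) uvw(1) by blast
  moreover have "indep M {u, v, w}"
    using indep_subset[OF simple_matroidD[OF M] I(1)] J(1) uvw(1) by blast
  ultimately show False
    using uvw(2) unfolding collinear3_def by blast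
qed

lemma rank_le_iff:
  "rank M X \<le> enat n \<longleftrightarrow> (\<forall>I. I \<subseteq> X \<longrightarrow> finite I \<longrightarrow> indep M I \<longrightarrow> card I \<le> n)"
  unfolding rank_def by (auto simp: SUP_le_iff)

lemma rank_ge: "I \<subseteq> X \<Longrightarrow> finite I \<Longrightarrow> indep M I \<Longrightarrow> enat (card I) \<le> rank M X"
  unfolding rank_def by (rule SUP_upper) auto

lemma collinear_triple:
  assumes "simple_matroid M" "distinct [a, b, c]"
  shows "collinear M {a, b, c} \<longleftrightarrow> collinear3 M a b c"
proof
  assume c: "collinear M {a, b, c}"
  then have "rank M {a, b, c} \<le> enat 2" "{a, b, c} \<subseteq> ground M"
    unfolding collinear_def by (auto simp: numeral_eq_enat)
  then have "\<not> indep M {a, b, c}"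
    using assms(2) rank_le_iff[THEN iffD1, rule_format, of M "{a, b, c}" 2 "{a, b, c}"] by auto
  then show "collinear3 M a b c"
    using \<open>{a, b, c} \<subseteq> ground M\<close> unfolding collinear3_def by blast
next
  assume c: "collinear3 M a b c"
  have "collinear3 M a b a" "collinear3 M a b b"
    using collinear3_ground[OF c] unfolding collinear3_def by auto
  then have "{a, b, c} \<subseteq> {d. collinear3 M a b d}"
    using c by simp
  then have "card I \<le> 2" if "I \<subseteq> {a, b, c}" "indep M I" for I
    using indep_in_line[OF assms(1), of a b I] assms(2) that by auto
  then have "rank M {a, b, c} \<le> enat 2"
    unfolding rank_le_iff by blast
  then show "collinear M {a, b, c}"
    using collinear3_ground[OF c] unfolding collinear_def by (auto simp: numeral_eq_enat)
qed

lemma cl_pair: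
  assumes M: "simple_matroid M" and "a \<noteq> b" "a \<in> ground M" "b \<in> ground M"
  shows "cl M {a, b} = {c. collinear3 M a b c}"
proof (intro set_eqI iffI)
  fix e assume e: "e \<in> cl M {a, b}"
  show "e \<in> {c. collinear3 M a b c}"
  proof (rule ccontr)
    assume "e \<notin> {c. collinear3 M a b c}"
    then have "distinct [a, b, e]" "indep M {a, b, e}"
      using assms e unfolding collinear3_def cl_def by auto
    moreover obtain I where "I \<subseteq> {a, b}" "\<not> indep M (insert e I)"
      using e calculation(1) unfolding cl_def by auto
    ultimately show False
      using indep_subset[OF simple_matroidD[OF M], of "{a, b, e}" "insert e I"] by auto
  qed
next
  fix e assume "e \<in> {c. collinear3 M a b c}"
  then have "collinear3 M a b e" by simp
  then have "e \<in> ground M" "e \<in> {a, b} \<or> \<not> indep M (insert e {a, b})"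
    using \<open>a \<noteq> b\<close> unfolding collinear3_def by (auto simp: insert_commute)
  then show "e \<in> cl M {a, b}"
    using indep_pair[OF M assms(3,4)] unfolding cl_def by blast
qed

text \<open>
  A point \<open>e\<close> outside the line through \<open>a\<close> and \<open>b\<close> is independent of them. An independent set inside
  the line can be enlarged from \<open>{a, b, e}\<close>, and once it cannot grow inside the line, the only
  element left to add is \<open>e\<close>; hence \<open>e\<close> is not in the closure of the line.
\<close>

lemma line_is_flat:
  assumes M: "simple_matroid M" and "a \<noteq> b" "a \<in> ground M" "b \<in> ground M"
  shows "cl M {c. collinear3 M a b c} = {c. collinear3 M a b c}" (is "cl M ?L = ?L")
proof
  show "?L \<subseteq> cl M ?L"
    using collinear3_ground unfolding cl_def by fast
  show "cl M ?L \<subseteq> ?L"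
  proof (rule ccontr)
    assume "\<not> cl M ?L \<subseteq> ?L"
    then obtain e where e: "e \<in> cl M ?L" "\<not> collinear3 M a b e" by auto
    then obtain I where I: "I \<subseteq> ?L" "indep M I" "\<not> indep M (insert e I)"
      unfolding cl_def by auto
    have abe: "distinct [a, b, e]" "indep M {a, b, e}" and eg: "e \<in> ground M"
      using e assms unfolding collinear3_def cl_def by auto
    have fin: "finite I" "card I \<le> 2"
      using indep_in_line[OF M \<open>a \<noteq> b\<close> I(2,1)] by auto
    have ab: "collinear3 M a b a" "collinear3 M a b b"
      using assms unfolding collinear3_def by auto
    have pair: False if "card I \<le> 1"
    proof -
      have "\<exists>g\<in>ground M. I \<subseteq> {g}"
      proof (cases "I = {}")
        case True
        then show ?thesis using assms(3) by blast
      next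
        case False
        then have "card I = 1"
          using that fin(1) by (simp add: le_Suc_eq)
        then obtain g where "I = {g}" by (rule card_1_singletonE)
        then show ?thesis
          using indep_ground[OF simple_matroidD[OF M] I(2)] by blast
      qed
      then obtain g where "g \<in> ground M" "I \<subseteq> {g}" by blast
      then have "indep M {e, g}" "insert e I \<subseteq> {e, g}"
        using indep_pair[OF M eg] by auto
      then show False
        using I(3) indep_subset[OF simple_matroidD[OF M]] by blast
    qed
    obtain d where d: "d \<in> {a, b, e} - I" "indep M (insert d I)"
      by (rule indep_augment[OF simple_matroidD[OF M] I(2) abe(2) fin(1)]) (use abe fin in auto)
    have "d \<noteq> e" using d I(3) by auto
    then have "insert d I \<subseteq> ?L"
      using d I(1) ab by auto
    then have "card (insert d I) \<le> 2"
      using indep_in_line[OF M \<open>a \<noteq> b\<close> d(2)] by blast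
    then show False
      using pair d(1) fin(1) by simp
  qed
qed

text \<open>
  The rank-two flats are the sets of points collinear with two given points, so lines can be
  handled through collinear triples alone.
\<close>

lemma lines_iff:
  assumes M: "simple_matroid M"
  shows "L \<in> lines M \<longleftrightarrow>
    (\<exists>a\<in>ground M. \<exists>b\<in>ground M. a \<noteq> b \<and> L = {c. collinear3 M a b c})"
proof
  assume "L \<in> lines M"
  then have L: "L \<subseteq> ground M" "cl M L = L" "rank M L = 2"
    unfolding lines_def by auto
  have "\<not> rank M L \<le> enat 1" and le2: "rank M L \<le> enat 2"
    using L(3) by (auto simp: numeral_eq_enat)
  then obtain I where I: "I \<subseteq> L" "finite I" "indep M I" "card I = 2"
    unfolding rank_le_iff by (metis Suc_1 le_antisym not_less_eq_eq)
  then obtain a b where ab: "I = {a, b}" "a \<noteq> b"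
    by (auto simp: card_2_iff)
  have "L \<subseteq> {c. collinear3 M a b c}"
  proof
    fix c assume "c \<in> L"
    then have "\<not> (distinct [a, b, c] \<and> indep M {a, b, c})"
      using I(1) ab rank_le_iff[THEN iffD1, rule_format, OF le2, of "{a, b, c}"] by auto
    then show "c \<in> {c. collinear3 M a b c}"
      using L(1) I(1) ab \<open>c \<in> L\<close> unfolding collinear3_def by auto
  qed
  moreover have "{c. collinear3 M a b c} \<subseteq> L"
  proof
    fix c assume c: "c \<in> {c. collinear3 M a b c}"
    then have "c \<in> L \<or> \<not> indep M (insert c I)"
      using I(1) ab unfolding collinear3_def by (auto simp: insert_commute)
    then have "c \<in> cl M L"
      using c I(1,3) unfolding cl_def collinear3_def by auto
    then show "c \<in> L" using L(2) by simp
  qed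
  ultimately show "\<exists>a\<in>ground M. \<exists>b\<in>ground M. a \<noteq> b \<and> L = {c. collinear3 M a b c}"
    using ab I(1) L(1) by blast
next
  assume "\<exists>a\<in>ground M. \<exists>b\<in>ground M. a \<noteq> b \<and> L = {c. collinear3 M a b c}"
  then obtain a b where ab: "a \<in> ground M" "b \<in> ground M" "a \<noteq> b" and L: "L = {c. collinear3 M a b c}"
    by blast
  have "rank M L \<le> enat 2"
    unfolding rank_le_iff using indep_in_line[OF M ab(3)] L by auto
  moreover have "{a, b} \<subseteq> L"
    using ab unfolding L collinear3_def by auto
  then have "enat (card {a, b}) \<le> rank M L"
    by (intro rank_ge) (use indep_pair[OF M ab(1,2)] in auto)
  then have "enat 2 \<le> rank M L"
    using ab(3) by (metis card_2_iff)
  ultimately have "rank M L = 2"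
    by (auto simp: numeral_eq_enat)
  then show "L \<in> lines M"
    using line_is_flat[OF M ab(3,1,2)] collinear3_ground unfolding L lines_def by fast
qed

lemma restriction_simple:
  assumes M: "simple_matroid M"
  shows "simple_matroid (restriction M S)"
proof -
  note m = simple_matroidD[OF M]
  have 1: "\<exists>e\<in>Y - X. (indep M (insert e X) \<and> insert e X \<subseteq> S)"
    if P: "indep M X \<and> X \<subseteq> S" "indep M Y \<and> Y \<subseteq> S" "finite X" "finite Y" "card X < card Y" for X Y
  proof -
    obtain e where "e \<in> Y - X" "indep M (insert e X)"
      using indep_augment[OF m P(1)[THEN conjunct1] P(2)[THEN conjunct1] P(3-5)] by metis
    then show ?thesis using P(1,2) by blast
  qed
  have 2: "indep M X \<and> X \<subseteq> S"
    if "X \<subseteq> ground M \<inter> S" "\<forall>Y. Y \<subseteq> X \<longrightarrow> finite Y \<longrightarrow> indep M Y \<and> Y \<subseteq> S" for X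
  proof -
    have "indep M X"
    proof (rule indep_finitary[OF m])
      show "X \<subseteq> ground M" using that(1) by blast
      show "indep M Y" if "Y \<subseteq> X" "finite Y" for Y
        using \<open>\<forall>Y. Y \<subseteq> X \<longrightarrow> _\<close> that by blast
    qed
    then show ?thesis using that(1) by blast
  qed
  have 3: "indep M {}"
    by (rule m[unfolded matroid_def, THEN conjunct2, THEN conjunct1])
  have "matroid (restriction M S)"
    unfolding matroid_def
  proof (intro conjI allI impI)
    fix X assume "indep (restriction M S) X"
    then show "X \<subseteq> ground (restriction M S)"
      using indep_ground[OF m] unfolding restriction_def by auto
  next
    show "indep (restriction M S) {}"
      using 3 unfolding restriction_def by simp
  next
    fix X Y assume "indep (restriction M S) Y" "X \<subseteq> Y"
    then show "indep (restriction M S) X"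
      using indep_subset[OF m] unfolding restriction_def by auto
  next
    fix X Y
    assume "indep (restriction M S) X" "indep (restriction M S) Y"
      "finite X" "finite Y" "card X < card Y"
    then show "\<exists>e\<in>Y - X. indep (restriction M S) (insert e X)"
      unfolding restriction_def matroid_struct.simps by (rule 1)
  next
    fix X
    assume "X \<subseteq> ground (restriction M S)"
      "\<forall>Y\<subseteq>X. finite Y \<longrightarrow> indep (restriction M S) Y"
    then show "indep (restriction M S) X"
      unfolding restriction_def matroid_struct.simps by (rule 2)
  qed
  moreover have "indep (restriction M S) {a, b}"
    if "a \<in> ground (restriction M S)" "b \<in> ground (restriction M S)" for a b
    using indep_pair[OF M, of a b] that unfolding restriction_def by simp
  ultimately show ?thesis
    unfolding simple_matroid_def by blast
qed

lemma collinear3_restriction: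
  "collinear3 (restriction M S) a b c \<longleftrightarrow> collinear3 M a b c \<and> {a, b, c} \<subseteq> S"
  unfolding collinear3_def restriction_def by auto

lemma lines_restriction_iff:
  assumes "simple_matroid M" "S \<subseteq> ground M"
  shows "L \<in> lines (restriction M S) \<longleftrightarrow>
    (\<exists>a\<in>S. \<exists>b\<in>S. a \<noteq> b \<and> L = {c\<in>S. collinear3 M a b c})"
proof -
  have g: "ground (restriction M S) = S"
    using assms(2) unfolding restriction_def by auto
  have "{c. collinear3 (restriction M S) a b c} = {c\<in>S. collinear3 M a b c}" if "a \<in> S" "b \<in> S" for a b
    using that unfolding collinear3_restriction by auto
  then show ?thesis
    unfolding lines_iff[OF restriction_simple[OF assms(1)]] g by auto
qed

section \<open>Quadrangles in a linear space\<close>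

locale linear_space =
  fixes pts :: "'a set" and col :: "'a \<Rightarrow> 'a \<Rightarrow> 'a \<Rightarrow> bool"
  assumes col_pts: "col a b c \<Longrightarrow> a \<in> pts \<and> b \<in> pts \<and> c \<in> pts"
    and col_degenerate: "a \<in> pts \<Longrightarrow> b \<in> pts \<Longrightarrow> col a a b"
    and col_swap12: "col a b c \<Longrightarrow> col b a c"
    and col_swap23: "col a b c \<Longrightarrow> col a c b"
    and col_trans: "a \<noteq> b \<Longrightarrow> col a b c \<Longrightarrow> col a b d \<Longrightarrow> col a c d"
begin

lemma col_perms:
  assumes "col a b c"
  shows "col a c b" "col b a c" "col b c a" "col c a b" "col c b a"
  using assms col_swap12 col_swap23 by blast+

lemma noncol_perms:
  assumes "\<not> col a b c"
  shows "\<not> col a c b" "\<not> col b a c" "\<not> col b c a" "\<not> col c a b" "\<not> col c b a"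
  using assms col_perms by blast+

lemma col_on_line:
  assumes "a \<noteq> b" "col a b c" "col a b d" "col a b e"
  shows "col c d e"
proof (cases "c = a")
  case True
  then show ?thesis using col_trans assms by metis
next
  case False
  have "col c a d" "col c a e"
    using col_trans[OF assms(1)] assms(2-4) col_swap12 by metis+
  then show ?thesis
    using col_trans[OF False] by blast
qed

text \<open>Two distinct points common to two lines put all points of both lines on one line.\<close>

lemma col_merge:
  assumes "u \<noteq> v" "a \<noteq> b" "col a b u" "col a b v" "col u v c"
  shows "col a b c"
proof -
  have "col u v a" "col u v b"
    using col_on_line[OF assms(2)] assms(3,4) col_degenerate col_pts col_swap12 col_swap23 by metis+
  then show ?thesis
    using col_on_line[OF assms(1)] assms(5) by blast
qed

text \<open>
  The points \<open>o'\<close>, \<open>q\<close>, \<open>r\<close>, \<open>s\<close> form a quadrangle, \<open>y\<close> and \<open>z\<close> are two of its diagonal points,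
  and \<open>x\<close> is the point where the side \<open>q s\<close> meets the diagonal \<open>y z\<close>.
\<close>

definition quad :: "'a \<Rightarrow> 'a \<Rightarrow> 'a \<Rightarrow> 'a \<Rightarrow> 'a \<Rightarrow> 'a \<Rightarrow> 'a \<Rightarrow> bool" where
  "quad y x z o' q r s \<longleftrightarrow>
     \<not> col o' q r \<and> \<not> col o' q s \<and> \<not> col o' r s \<and> \<not> col q r s \<and>
     col y o' q \<and> col y r s \<and> col z o' s \<and> col z q r \<and> col x q s \<and> col y x z"

text \<open>
  The reflections of the square \<open>o' q r s\<close> in its two diagonals interchange \<open>y\<close> and \<open>z\<close>.
  They reduce the case distinctions below to a few representatives.
\<close>

lemma quad_sym: "quad y x z o' q r s \<Longrightarrow> quad z x y o' s r q"
  unfolding quad_def by (meson col_swap12 col_swap23)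

lemma quad_sym': "quad y x z o' q r s \<Longrightarrow> quad z x y r q o' s"
  unfolding quad_def by (meson col_swap12 col_swap23)

lemma diagonal_points:
  assumes "quad y x z o' q r s"
  shows "y \<noteq> o'" "y \<noteq> z" "\<not> col y z o'" "\<not> col o' q z" "\<not> col y z q"
proof -
  note d = assms[unfolded quad_def]
  note p = col_pts col_perms col_degenerate
  have pts: "o' \<in> pts" "q \<in> pts" "r \<in> pts" "s \<in> pts" "y \<in> pts" "z \<in> pts"
    using d col_pts by blast+
  have ne: "o' \<noteq> q" "o' \<noteq> r" "o' \<noteq> s"
    using d pts col_degenerate col_perms by metis+
  show yo: "y \<noteq> o'"
    using d col_perms by metis
  have zo: "z \<noteq> o'"
    using d col_perms by metis
  show oqz: "\<not> col o' q z"
    using d zo ne pts col_on_line[of o' z o' q s] col_perms col_degenerate by metis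
  then show yz: "y \<noteq> z"
    using d col_perms by metis
  show yzo: "\<not> col y z o'"
    using yo oqz d col_on_line[of y o' o' q z] col_perms col_degenerate pts by metis
  have "y \<noteq> q"
    using d col_perms by metis
  then show "\<not> col y z q"
    using yzo d col_trans[of y q o' z] col_perms by metis
qed

lemma quad_distinct:
  assumes "quad y x z o' q r s"
  shows "distinct [y, x, z, o', q, r, s]"
proof -
  note d = assms[unfolded quad_def]
  have pts: "o' \<in> pts" "q \<in> pts" "r \<in> pts" "s \<in> pts" "y \<in> pts" "z \<in> pts" "x \<in> pts"
    using d col_pts by blast+
  note q = diagonal_points[OF assms] diagonal_points[OF quad_sym[OF assms]]
    diagonal_points[OF quad_sym'[OF assms]] diagonal_points[OF quad_sym[OF quad_sym'[OF assms]]]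
  have ne: "o' \<noteq> q" "o' \<noteq> r" "o' \<noteq> s" "q \<noteq> r" "q \<noteq> s" "r \<noteq> s"
    using d pts col_perms(1,2,3) col_degenerate by metis+
  moreover have ne': "y \<noteq> q" "y \<noteq> r" "y \<noteq> s" "z \<noteq> o'" "z \<noteq> q" "z \<noteq> r" "z \<noteq> s"
    using d q pts col_perms(1,2,3) col_degenerate by metis+
  moreover have "x \<noteq> y"
    using d ne' col_trans[of s y r q] col_perms by metis
  moreover have "x \<noteq> z"
    using d ne' col_trans[of s z o' q] col_perms by metis
  moreover have "x \<noteq> o'" "x \<noteq> r"
    using d col_perms by metis+
  moreover have "x \<noteq> q" "x \<noteq> s"
    using q d col_perms by metis+
  ultimately show ?thesis
    using q by auto
qed

text \<open>
  Together with the four triples of vertices, the images of these triples under the symmetries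
  are all triples of the seven points other than the six lines and \<open>{x, o', r}\<close>.
\<close>

lemma quad_noncollinear:
  assumes "quad y x z o' q r s"
  shows "\<not> col o' q z" "\<not> col o' q x" "\<not> col q s y" "\<not> col o' r y"
    "\<not> col y z o'" "\<not> col y x o'" "\<not> col x z o'" "\<not> col y z q" "\<not> col y x q" "\<not> col x z q"
proof -
  note d = assms[unfolded quad_def]
  have pts: "o' \<in> pts" "q \<in> pts" "r \<in> pts" "s \<in> pts" "y \<in> pts" "z \<in> pts" "x \<in> pts"
    using d col_pts by blast+
  note q = diagonal_points[OF assms] diagonal_points[OF quad_sym[OF assms]]
    diagonal_points[OF quad_sym'[OF assms]] diagonal_points[OF quad_sym[OF quad_sym'[OF assms]]]
  note D = quad_distinct[OF assms]
  show "\<not> col o' q z" by fact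
  show "\<not> col o' q x"
    using d D col_on_line[of q x q s o'] col_perms col_degenerate pts
    by (metis distinct_length_2_or_more)
  show "\<not> col q s y"
    using d D col_on_line[of y q q s o'] col_perms col_degenerate pts
    by (metis distinct_length_2_or_more)
  show "\<not> col o' r y"
    using d D col_on_line[of y o' q r o'] col_perms col_degenerate pts
    by (metis distinct_length_2_or_more)
  show yz: "\<not> col y z o'" by fact
  show yzq: "\<not> col y z q" by fact
  show "\<not> col y x o'" "\<not> col y x q"
    using yz yzq d D col_trans[of y x z] col_perms
    by (metis distinct_length_2_or_more)+
  show "\<not> col x z o'" "\<not> col x z q"
    using yz yzq d D col_trans[of z x y] col_perms
    by (metis distinct_length_2_or_more)+
qed

end

section \<open>Quadrangles and the configuration \<open>HP\<close> in a matroid\<close>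

lemma simple_matroid_linear_space:
  assumes "simple_matroid M"
  shows "linear_space (ground M) (collinear3 M)"
proof
  show "collinear3 M a b c \<Longrightarrow> a \<in> ground M \<and> b \<in> ground M \<and> c \<in> ground M" for a b c
    by (rule collinear3_ground)
  show "a \<in> ground M \<Longrightarrow> b \<in> ground M \<Longrightarrow> collinear3 M a a b" for a b
    by (rule collinear3_degenerate)
  show "collinear3 M a b c \<Longrightarrow> collinear3 M b a c" for a b c
    by (rule collinear3_swap12)
  show "collinear3 M a b c \<Longrightarrow> collinear3 M a c b" for a b c
    by (rule collinear3_swap23)
  show "a \<noteq> b \<Longrightarrow> collinear3 M a b c \<Longrightarrow> collinear3 M a b d \<Longrightarrow> collinear3 M a c d" for a b c d
    by (rule collinear3_trans[OF assms])
qed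

text \<open>
  The points \<open>y\<close>, \<open>z\<close>, \<open>q\<close> form a basis. The points \<open>x\<close>, \<open>o'\<close>, \<open>r\<close> lie on lines through two of
  them; if \<open>s\<close> were independent of them, then enlarging \<open>{o', q, s}\<close> to four independent points would
  add \<open>y\<close> or \<open>z\<close>, against the lines \<open>y o' q\<close> and \<open>z o' s\<close>.
\<close>

lemma quad_rank:
  assumes M: "simple_matroid M" and Q: "linear_space.quad (collinear3 M) y x z o' q r s"
  shows "rank M {y, x, z, o', q, r, s} = 3"
proof -
  interpret linear_space "ground M" "collinear3 M"
    by (rule simple_matroid_linear_space[OF M])
  note m = simple_matroidD[OF M]
  note d = Q[unfolded quad_def]
  have pts: "o' \<in> ground M" "q \<in> ground M" "r \<in> ground M" "s \<in> ground M"
    "y \<in> ground M" "z \<in> ground M" "x \<in> ground M"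
    using d col_pts by blast+
  have D: "distinct [y, x, z, o', q, r, s]"
    by (rule quad_distinct[OF Q])
  have dep: "\<not> indep M X" if "collinear3 M a b c" "distinct [a, b, c]" "{a, b, c} \<subseteq> X" for a b c X
    using that indep_subset[OF m] unfolding collinear3_def by blast
  have ind: "indep M {a, b, c}" if "\<not> collinear3 M a b c" "{a, b, c} \<subseteq> ground M" for a b c
    using that unfolding collinear3_def by blast
  have i1: "indep M {y, z, q}"
    by (rule ind) (use pts quad_noncollinear[OF Q] in blast)+
  have dep4: "\<not> indep M {y, z, q, e}" if e: "e \<in> {x, o', r, s}" for e
  proof
    assume i: "indep M {y, z, q, e}"
    have "\<not> indep M {y, z, q, x}"
      by (rule dep[of y x z]) (use d D in simp_all)
    moreover have "\<not> indep M {y, z, q, o'}"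
      by (rule dep[of y o' q]) (use d D in simp_all)
    moreover have "\<not> indep M {y, z, q, r}"
      by (rule dep[of z q r]) (use d D in simp_all)
    ultimately have "e = s"
      using e i by blast
    with i have i: "indep M {y, z, q, s}" by simp
    have i3: "indep M {o', q, s}"
      by (rule ind) (use pts d in auto)
    obtain e where e: "e \<in> {y, z, q, s} - {o', q, s}" "indep M (insert e {o', q, s})"
      by (rule indep_augment[OF m i3 i]) (use D in auto)
    moreover have "\<not> indep M (insert y {o', q, s})"
      by (rule dep[of y o' q]) (use d D in simp_all)
    moreover have "\<not> indep M (insert z {o', q, s})"
      by (rule dep[of z o' s]) (use d D in simp_all)
    ultimately show False by blast
  qed
  have "card I \<le> 3" if I: "I \<subseteq> {y, x, z, o', q, r, s}" "finite I" "indep M I" for I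
  proof (rule ccontr)
    assume "\<not> card I \<le> 3"
    then have "card {y, z, q} < card I"
      using D by simp
    then obtain e where e: "e \<in> I - {y, z, q}" "indep M (insert e {y, z, q})"
      using indep_augment[OF m i1 I(3) _ I(2)] by blast
    moreover have "insert e {y, z, q} = {y, z, q, e}"
      by blast
    moreover have "e \<in> {x, o', r, s}"
      using e(1) I(1) by blast
    ultimately show False
      using dep4[of e] by simp
  qed
  then have "rank M {y, x, z, o', q, r, s} \<le> enat 3"
    unfolding rank_le_iff by blast
  moreover have "enat (card {y, z, q}) \<le> rank M {y, x, z, o', q, r, s}"
    by (rule rank_ge) (use i1 in auto)
  moreover have "card {y, z, q} = 3"
    using D by auto
  ultimately show ?thesis
    by (metis antisym numeral_eq_enat)
qed

text \<open>
  \<open>HP\<close> prescribes the whole restriction to the seven points, whereas the quadrangle only names its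
  four noncollinear triples and six lines. All other triples are noncollinear
  by incidence alone, except \<open>{x, o', r}\<close>, which is the difference between the non-Fano and the
  Fano matroid.
\<close>

lemma quad_HP:
  assumes M: "simple_matroid M" and Q: "linear_space.quad (collinear3 M) y x z o' q r s"
  shows "HP M y x z o' q r s"
proof -
  interpret linear_space "ground M" "collinear3 M"
    by (rule simple_matroid_linear_space[OF M])
  define S where "S = {y, x, z, o', q, r, s}"
  define N where "N = restriction M S"
  define \<Lambda> where "\<Lambda> = {{y, x, z}, {y, o', q}, {y, r, s}, {x, q, s}, {z, o', s}, {z, q, r}}"
  define T where "T = (if collinear3 M x o' r then insert {x, o', r} \<Lambda> else \<Lambda>)"
  note d = Q[unfolded quad_def]
  have D: "distinct [y, x, z, o', q, r, s]"
    by (rule quad_distinct[OF Q])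
  have sub: "S \<subseteq> ground M"
    using d col_pts unfolding S_def by blast
  note n = quad_noncollinear[OF Q] quad_noncollinear[OF quad_sym[OF Q]]
    quad_noncollinear[OF quad_sym'[OF Q]] quad_noncollinear[OF quad_sym[OF quad_sym'[OF Q]]]
  have d': "\<not> collinear3 M o' q r" "\<not> collinear3 M o' q s" "\<not> collinear3 M o' r s"
    "\<not> collinear3 M q r s"
    using d by blast+
  note neg = n n[THEN noncol_perms(1)] n[THEN noncol_perms(2)] n[THEN noncol_perms(3)]
    n[THEN noncol_perms(4)] n[THEN noncol_perms(5)]
    d' d'[THEN noncol_perms(1)] d'[THEN noncol_perms(2)] d'[THEN noncol_perms(3)]
    d'[THEN noncol_perms(4)] d'[THEN noncol_perms(5)]
  have c: "collinear3 M y x z" "collinear3 M y o' q" "collinear3 M y r s" "collinear3 M x q s"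
    "collinear3 M z o' s" "collinear3 M z q r"
    using d by blast+
  (* Going through all triples at once: the negative facts leave only the seven lines. *)
  have three: "\<forall>a\<in>S. \<forall>b\<in>S. \<forall>c\<in>S. distinct [a, b, c] \<longrightarrow> collinear3 M a b c \<longrightarrow> {a, b, c} \<in> T"
  proof (cases "collinear3 M x o' r")
    case True
    then show ?thesis
      using D unfolding S_def T_def \<Lambda>_def by (simp add: neg insert_commute)
  next
    case False
    then show ?thesis
      using D noncol_perms[OF False] unfolding S_def T_def \<Lambda>_def
      by (simp add: neg insert_commute)
  qed
  have full: "{e \<in> S. collinear3 M a b e} = {a, b, c}"
    if abc: "collinear3 M a b c" "distinct [a, b, c]" "{a, b, c} \<subseteq> S"
      and other: "\<And>e. e \<in> S - {a, b, c} \<Longrightarrow> \<not> collinear3 M a b e" for a b c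
  proof -
    have "collinear3 M a b a" "collinear3 M a b b"
      using abc(1) unfolding collinear3_def by auto
    then show ?thesis
      using abc(1,3) other by blast
  qed
  have lines: "{a, b, c} \<in> lines N \<and> card {a, b, c} = 3"
    if "collinear3 M a b c" "distinct [a, b, c]" "{a, b, c} \<subseteq> S"
      "\<And>e. e \<in> S - {a, b, c} \<Longrightarrow> \<not> collinear3 M a b e" for a b c
  proof -
    have "{a, b, c} \<in> lines N"
      unfolding N_def lines_restriction_iff[OF M sub]
      using that(2,3) full[OF that, symmetric] by auto
    then show ?thesis using that(2) by simp
  qed
  have "{y, x, z} \<in> lines N \<and> card {y, x, z} = 3" "{y, o', q} \<in> lines N \<and> card {y, o', q} = 3"
    "{y, r, s} \<in> lines N \<and> card {y, r, s} = 3" "{x, q, s} \<in> lines N \<and> card {x, q, s} = 3"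
    "{z, o', s} \<in> lines N \<and> card {z, o', s} = 3" "{z, q, r} \<in> lines N \<and> card {z, q, r} = 3"
    by (rule lines; use c D in \<open>auto simp: S_def neg\<close>)+
  moreover have "{x, o', r} \<in> lines N \<and> card {x, o', r} = 3" if "collinear3 M x o' r"
    by (rule lines; use that D in \<open>auto simp: S_def neg\<close>)
  ultimately have T1: "T \<subseteq> {L \<in> lines N. card L = 3}"
    unfolding T_def \<Lambda>_def by auto
  have T2: "L \<in> T" if L: "L \<in> lines N" "card L = 3" for L
  proof -
    obtain a b where ab: "a \<noteq> b" "L = {e \<in> S. collinear3 M a b e}"
      using L(1) unfolding N_def lines_restriction_iff[OF M sub] by blast
    obtain u v w where uvw: "L = {u, v, w}" "distinct [u, v, w]"
      using L(2) by (auto simp: card_3_iff)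
    then have "collinear3 M u v w" "u \<in> S" "v \<in> S" "w \<in> S"
      using ab col_on_line[OF ab(1)] by blast+
    then show ?thesis
      using three uvw by blast
  qed
  have T3: "A \<in> T" if A: "A \<subseteq> S" "card A = 3" "collinear N A" for A
  proof -
    obtain u v w where uvw: "A = {u, v, w}" "distinct [u, v, w]"
      using A(2) by (auto simp: card_3_iff)
    then have "collinear3 M u v w"
      using A(3) collinear_triple[OF restriction_simple[OF M] uvw(2), of S]
        collinear3_restriction[of M S u v w] unfolding N_def by blast
    then show ?thesis
      using three uvw A(1) by blast
  qed
  have "ground N = S"
    using sub unfolding N_def restriction_def by auto
  moreover have "rank N S = 3"
  proof -
    have "{I. I \<subseteq> S \<and> finite I \<and> indep N I} = {I. I \<subseteq> S \<and> finite I \<and> indep M I}"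
      unfolding N_def restriction_def by auto
    then show ?thesis
      using quad_rank[OF M Q] unfolding rank_def S_def by simp
  qed
  moreover have "{L \<in> lines N. card L = 3} = T"
    using T1 T2 by blast
  moreover have "T = \<Lambda> \<or> T = insert {x, o', r} \<Lambda>"
    unfolding T_def by simp
  ultimately show ?thesis
    using D sub T3 unfolding HP_def Let_def S_def[symmetric] N_def[symmetric] \<Lambda>_def[symmetric]
    by simp
qed

text \<open>
  This half of the converse is what is needed to see that a harmonic conjugate is
  only ever formed for three points of a line.
\<close>

lemma HP_line:
  assumes M: "simple_matroid M" and H: "HP M y x z o' q r s"
  shows "distinct [y, x, z]" "collinear3 M y x z"
proof -
  define S where "S = {y, x, z, o', q, r, s}"
  have sub: "S \<subseteq> ground M" and "distinct [y, x, z]"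
    and "{y, x, z} \<in> lines (restriction M S)"
    using H unfolding HP_def Let_def S_def[symmetric] by auto
  then obtain a b where ab: "a \<noteq> b" "{y, x, z} = {e \<in> S. collinear3 M a b e}"
    unfolding lines_restriction_iff[OF M sub] by blast
  then show "collinear3 M y x z"
    using collinear3_on_line[OF M ab(1)] by blast
  show "distinct [y, x, z]" by fact
qed

section \<open>Coordinates modulo \<open>p\<close> on the points of a linear space\<close>

text \<open>
  \<open>P x y\<close> is the affine point \<open>(x, y)\<close>, \<open>D j\<close> is the point at infinity of the lines of slope \<open>j\<close>,
  and \<open>c\<close> is the point at infinity of the vertical lines. Only the presence of the expected
  collinearities and one noncollinear triple are demanded; that there are no further
  collinearities is a consequence.
\<close>

locale coordinatized = linear_space +
  fixes p :: int and P :: "int \<Rightarrow> int \<Rightarrow> 'a" and D :: "int \<Rightarrow> 'a" and c :: 'a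
  assumes prime_p: "prime p"
    and P_eq_iff: "P x y = P x' y' \<longleftrightarrow> [x = x'] (mod p) \<and> [y = y'] (mod p)"
    and D_eq_iff: "D i = D j \<longleftrightarrow> [i = j] (mod p)"
    and P_not_D: "P x y \<noteq> D j"
    and P_not_c: "P x y \<noteq> c"
    and D_not_c: "D j \<noteq> c"
    and sloped_line: "col (P 0 i) (P x (i + j * x)) (D j)"
    and vertical_line: "col c (P x y) (P x y')"
    and infinite_line: "col c (D i) (D j)"
    and not_on_a_line: "\<not> col c (P 0 0) (D 0)"

section \<open>Nets on three concurrent lines\<close>

text \<open>
  The harmonic axioms in terms of quadrangles: the two lines meet, and the point where they meet
  depends on \<open>y\<close>, \<open>x\<close>, \<open>z\<close> only.
\<close>

locale harmonic_space = linear_space +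
  assumes quad_meet: "quad y x z o' q r s \<Longrightarrow> \<exists>x'. col y z x' \<and> col o' r x'"
    and quad_unique: "quad y x z o' q r s \<Longrightarrow> quad y x z o'' q' r' s' \<Longrightarrow>
      col y z x' \<Longrightarrow> col o' r x' \<Longrightarrow> col y z x'' \<Longrightarrow> col o'' r' x'' \<Longrightarrow> x' = x''"
begin

definition hconj :: "'a \<Rightarrow> 'a \<Rightarrow> 'a \<Rightarrow> 'a \<Rightarrow> bool" where
  "hconj y z x x' \<longleftrightarrow> (\<exists>o' q r s. quad y x z o' q r s \<and> col y z x' \<and> col o' r x')"

text \<open>
  The incidences of \<open>L\<^sub>p\<close>: three lines through \<open>c\<close> whose other points \<open>A i\<close>, \<open>B i\<close>, \<open>D i\<close> are
  numbered by integers modulo \<open>p\<close>. In coordinates \<open>A i = (0, i)\<close>, \<open>B i = (1, i)\<close>, and \<open>D j\<close> is the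
  point at infinity of the lines of slope \<open>j\<close>. Numbering by all integers keeps residues out of the
  index arithmetic.
\<close>

definition net :: "int \<Rightarrow> (int \<Rightarrow> 'a) \<Rightarrow> (int \<Rightarrow> 'a) \<Rightarrow> (int \<Rightarrow> 'a) \<Rightarrow> 'a \<Rightarrow> bool" where
  "net p A B D c \<longleftrightarrow>
     (\<forall>i j. col c (A i) (A j) \<and> col c (B i) (B j) \<and> col c (D i) (D j)) \<and>
     (\<forall>i j. \<not> col c (A i) (B j) \<and> \<not> col c (A i) (D j) \<and> \<not> col c (B i) (D j)) \<and>
     (\<forall>i j. (A i = A j \<longleftrightarrow> [i = j] (mod p)) \<and> (B i = B j \<longleftrightarrow> [i = j] (mod p)) \<and>
            (D i = D j \<longleftrightarrow> [i = j] (mod p))) \<and>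
     (\<forall>i j. col (A i) (B (i + j)) (D j))"

lemma netD:
  assumes "net p A B D c"
  shows "col c (A i) (A j)" "col c (B i) (B j)" "col c (D i) (D j)"
    "\<not> col c (A i) (B j)" "\<not> col c (A i) (D j)" "\<not> col c (B i) (D j)"
    "A i = A j \<longleftrightarrow> [i = j] (mod p)" "B i = B j \<longleftrightarrow> [i = j] (mod p)"
    "D i = D j \<longleftrightarrow> [i = j] (mod p)"
    "col (A i) (B (i + j)) (D j)"
  using assms unfolding net_def by blast+

lemma net_pts:
  assumes "net p A B D c"
  shows "c \<in> pts" "A i \<in> pts" "B i \<in> pts" "D i \<in> pts"
  using netD(1,2,3)[OF assms] col_pts by metis+

lemma net_col_iff:
  assumes N: "net p A B D c"
  shows "col (A i) (B k) (D j) \<longleftrightarrow> [k = i + j] (mod p)"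
proof
  assume k: "[k = i + j] (mod p)"
  then have "B k = B (i + j)"
    using netD(8)[OF N] by blast
  then show "col (A i) (B k) (D j)"
    using netD(10)[OF N] by simp
next
  assume 1: "col (A i) (B k) (D j)"
  show "[k = i + j] (mod p)"
  proof (rule ccontr)
    assume "\<not> [k = i + j] (mod p)"
    then have ne: "B k \<noteq> B (i + j)"
      using netD(8)[OF N] by blast
    have "A i \<noteq> D j"
      using netD(5)[OF N, of i j] netD(1)[OF N, of i i] by metis
    then have "col (A i) (D j) c"
      using col_merge[OF ne, of "A i" "D j" c] 1 netD(10)[OF N, of i j] netD(2)[OF N, of k "i + j"]
        col_perms by metis
    then show False
      using netD(5)[OF N, of i j] col_perms by blast
  qed
qed

text \<open>
  A quadrangle for the three points of the net line of slope \<open>j\<close> through \<open>A i\<close>, with an arbitrary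
  second point \<open>A m\<close> of the first line as a vertex. Its diagonal is the line through \<open>B (m + j)\<close> of
  slope \<open>i + j - m\<close>.
\<close>

lemma net_quad:
  assumes N: "net p A B D c" and m: "\<not> [m = i] (mod p)"
  shows "quad (B (i + j)) (A i) (D j) (D (i + j - m)) (A m) (B (m + j)) c"
proof -
  have "[m + j = m + (i + j - m)] (mod p) \<longleftrightarrow> [m = i] (mod p)"
    by (simp add: cong_add_rcancel)
  then have "\<not> col (A m) (B (m + j)) (D (i + j - m))"
    using m net_col_iff[OF N] by blast
  moreover have "col (A m) (B (i + j)) (D (i + j - m))"
    using netD(10)[OF N, of m "i + j - m"] by simp
  ultimately show ?thesis
    using netD[OF N] unfolding quad_def by (meson col_perms)
qed

text \<open>
  The fourth harmonic point of \<open>(0, k)\<close> with respect to \<open>(1, k)\<close> and the point at infinity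
  of their line is \<open>(2, k)\<close>. Varying \<open>m\<close> in the quadrangle varies the diagonal over all
  other net lines that should pass through \<open>(2, k)\<close>; since the harmonic conjugate does not depend on
  the quadrangle, they all do.
\<close>

lemma net_fourth_point:
  assumes N: "net p A B D c" and p: "p > 1"
  shows "\<exists>Q. hconj (B k) (D 0) (A k) Q \<and> (\<forall>j. col (B (k - j)) (D j) Q)"
proof -
  have ne: "\<not> [k + 1 = k] (mod p)"
    using p by (simp add: cong_iff_dvd_diff zdvd_not_zless)
  note q1 = net_quad[OF N ne, of 0, simplified]
  obtain Q where Q: "col (B k) (D 0) Q" "col (D (- 1)) (B (k + 1)) Q"
    using quad_meet[OF q1] by auto
  have "col (B (k - j)) (D j) Q" for j
  proof (cases "[j = 0] (mod p)")
    case True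
    then have "D j = D 0" "B (k - j) = B k"
      using netD(8,9)[OF N] cong_diff[of k k p j 0] by auto
    then show ?thesis using Q(1) by simp
  next
    case False
    then have "\<not> [k - j = k] (mod p)"
      by (simp add: cong_iff_dvd_diff)
    note q2 = net_quad[OF N this, of 0, simplified]
    obtain Q' where Q': "col (B k) (D 0) Q'" "col (D j) (B (k - j)) Q'"
      using quad_meet[OF q2] by auto
    have "Q = Q'"
      using quad_unique[OF q1 q2] Q Q' by simp
    then show ?thesis using Q'(2) col_swap12 by simp
  qed
  moreover have "hconj (B k) (D 0) (A k) Q"
    unfolding hconj_def using q1 Q by auto
  ultimately show ?thesis by blast
qed

text \<open>
  The fourth harmonic points again lie on a line through \<open>c\<close>: a second quadrangle for the same
  three points has \<open>c\<close> as a vertex, and its diagonal joins \<open>c\<close> to another fourth point.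
\<close>

lemma net_next:
  assumes N: "net p A B D c" and p: "p > 1"
  shows "\<exists>E. net p B E D c \<and> (\<forall>k. hconj (B k) (D 0) (A k) (E k))"
proof -
  (* The chosen points depend on k modulo p only, because their defining property does. *)
  define E where "E k = (SOME Q. hconj (B k) (D 0) (A k) Q \<and> (\<forall>j. col (B (k - j)) (D j) Q))" for k
  have E: "hconj (B k) (D 0) (A k) (E k)" "col (B (k - j)) (D j) (E k)" for k j
    using someI_ex[OF net_fourth_point[OF N p, of k]] unfolding E_def by auto
  have E': "col (B i) (E (i + j)) (D j)" for i j
    using E(2)[of "i + j" j] col_swap23 by simp
  have one: "\<not> [0 = 1] (mod p)"
    using p by (simp add: cong_iff_dvd_diff zdvd_not_zless)
  have ne: "D 0 \<noteq> D 1" "B k \<noteq> B (k - 1)" for k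
    using netD(8,9)[OF N] one cong_iff_dvd_diff[of k "k - 1" p] cong_iff_dvd_diff[of 0 1 p] by auto
  have ptsE: "E k \<in> pts" for k
    using E(2)[of k 0] col_pts by blast
  have cB: "\<not> col c (B u) (E k)" for u k
  proof
    assume u: "col c (B u) (E k)"
    have cBu: "c \<noteq> B u"
      using netD(6)[OF N, of u 0] netD(3)[OF N, of 0 0] netD(5)[OF N] net_pts[OF N] col_degenerate
      by metis
    have "E k = B (k - j)" for j
    proof (rule ccontr)
      assume n: "E k \<noteq> B (k - j)"
      have "col c (B u) (D j)"
        using col_merge[OF n cBu, of "D j"] u netD(2)[OF N, of u "k - j"] E(2)[of k j] col_perms
        by metis
      then show False using netD(6)[OF N] by blast
    qed
    from this[of 0] this[of 1] show False using ne(2)[of k] by simp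
  qed
  have cD: "\<not> col c (E k) (D u)" for u k
  proof
    assume u: "col c (E k) (D u)"
    have cDu: "c \<noteq> D u"
      using netD(6)[OF N, of 0 u] net_pts[OF N] col_degenerate col_perms by metis
    have "E k = D j" for j
    proof (rule ccontr)
      assume n: "E k \<noteq> D j"
      have "col c (D u) (B (k - j))"
        using col_merge[OF n cDu, of "B (k - j)"] u netD(3)[OF N, of u "j"] E(2)[of k j] col_perms
        by metis
      then show False using netD(6)[OF N] col_perms by blast
    qed
    from this[of 0] this[of 1] show False using ne(1) by simp
  qed
  have per: "E a = E b" if "[a = b] (mod p)" for a b
  proof -
    have "B (a - j) = B (b - j)" for j
      using netD(8)[OF N] that by (simp add: cong_diff)
    moreover have "B a = B b" "A a = A b"
      using netD(7,8)[OF N] that by blast+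
    ultimately show ?thesis
      unfolding E_def by simp
  qed
  have inj: "[a = b] (mod p)" if ab: "E a = E b" for a b
  proof (rule ccontr)
    assume "\<not> [a = b] (mod p)"
    then have n: "B a \<noteq> B b"
      using netD(8)[OF N] by blast
    have "E a \<noteq> D 0"
      using cD[of a 0] netD(3)[OF N, of 0 0] by metis
    then have "col (E a) (D 0) c"
      using col_merge[OF n, of "E a" "D 0" c] netD(2)[OF N, of a b] E(2)[of a 0] E(2)[of b 0] ab
        col_perms by (metis diff_zero)
    then show False
      using cD[of a 0] col_perms by blast
  qed
  have cE: "col c (E a) (E b)" for a b
  proof (cases "[a = b] (mod p)")
    case True
    then show ?thesis
      using per[OF True] col_degenerate net_pts[OF N] ptsE col_perms by metis
  next
    case False
    (* The quadrangle c, B b, E b, D (b - a) also yields the conjugate of A a. *)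
    define v where "v = b - a"
    have v: "D v \<noteq> D 0"
      using False netD(9)[OF N] unfolding v_def by (simp add: cong_iff_dvd_diff dvd_diff_commute)
    have "\<not> col (B b) (E b) (D v)"
    proof
      assume 1: "col (B b) (E b) (D v)"
      have 2: "col (B b) (E b) (D 0)"
        using E(2)[of b 0] col_swap23 by simp
      have "B b \<noteq> E b"
        using cB[of b b] netD(2)[OF N, of b b] by metis
      then have "col (B b) (E b) c"
        using col_merge[OF v _ 1 2] netD(3)[OF N, of v 0] col_perms by blast
      then show False using cB col_perms by blast
    qed
    moreover have "col (B a) (E b) (D v)" "col (B b) (E b) (D 0)" "col (A a) (B b) (D v)"
      using E'[of a v] E'[of b 0] netD(10)[OF N, of a v] unfolding v_def by auto
    moreover have "col (A a) (B a) (D 0)"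
      using netD(10)[OF N, of a 0] by simp
    ultimately have q2: "quad (B a) (A a) (D 0) c (B b) (E b) (D v)"
      using netD(2,3,6)[OF N] cB cD unfolding quad_def by (meson col_perms)
    have m: "\<not> [a + 1 = a] (mod p)"
      using p by (simp add: cong_iff_dvd_diff zdvd_not_zless)
    note q1 = net_quad[OF N m, of 0, simplified]
    obtain Q where Q: "col (B a) (D 0) Q" "col c (E b) Q"
      using quad_meet[OF q2] by auto
    have "E a = Q"
      using quad_unique[OF q1 q2 _ _ Q] E(2)[of a 0] E(2)[of a "- 1"] col_swap12 by simp
    then show ?thesis
      using Q(2) col_swap23 by blast
  qed
  have Eeq: "E a = E b \<longleftrightarrow> [a = b] (mod p)" for a b
    using per inj by blast
  have "net p B E D c"
    unfolding net_def
    by (intro conjI allI) (rule netD[OF N] cE cB cD Eeq E')+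
  then show ?thesis
    using E(1) by blast
qed

text \<open>
  Each step passes from the vertical lines \<open>x = n\<close>, \<open>x = n + 1\<close> to \<open>x = n + 1\<close>, \<open>x = n + 2\<close> and keeps
  the line at infinity, so \<open>P n\<close> is the vertical line \<open>x = n\<close>.
\<close>

lemma net_sequence:
  assumes N: "net p A B D c" and p: "p > 1"
  obtains P :: "nat \<Rightarrow> int \<Rightarrow> 'a"
  where "P 0 = A" "P 1 = B" "\<And>n. net p (P n) (P (Suc n)) D c"
    "\<And>n k. hconj (P (Suc n) k) (D 0) (P n k) (P (Suc (Suc n)) k)"
proof -
  define f where "f XY = (snd XY, SOME E. net p (snd XY) E D c \<and>
    (\<forall>k. hconj (snd XY k) (D 0) (fst XY k) (E k)))" for XY
  define P where "P n = fst ((f ^^ n) (A, B))" for n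
  have snd: "snd ((f ^^ n) (A, B)) = P (Suc n)" for n
    unfolding P_def f_def by simp
  have step: "net p (P (Suc n)) (P (Suc (Suc n))) D c \<and>
      (\<forall>k. hconj (P (Suc n) k) (D 0) (P n k) (P (Suc (Suc n)) k))"
    if n: "net p (P n) (P (Suc n)) D c" for n
  proof -
    have "P (Suc (Suc n)) = (SOME E. net p (P (Suc n)) E D c \<and>
        (\<forall>k. hconj (P (Suc n) k) (D 0) (P n k) (E k)))"
      using snd[of n] snd[of "Suc n"] P_def[of n] unfolding f_def by simp
    then show ?thesis
      using someI_ex[OF net_next[OF n p]] by simp
  qed
  have PA: "P 0 = A" and PB: "P 1 = B"
    unfolding P_def f_def by simp_all
  have nets: "net p (P n) (P (Suc n)) D c" for n
  proof (induction n)
    case 0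
    then show ?case using N PA PB by simp
  next
    case (Suc n)
    then show ?case using step by blast
  qed
  show thesis
    by (rule that[OF PA PB nets]) (use step nets in blast)
qed

text \<open>
  The first \<open>p\<close> vertical lines suffice: the line of slope \<open>j\<close> through \<open>(0, i)\<close> meets \<open>x = n\<close> in
  \<open>(n, i + j n)\<close> for every natural number \<open>n\<close>, and the second coordinate matters modulo \<open>p\<close> only.
  The lines of slopes \<open>0\<close> and \<open>-1\<close> through \<open>(n, i)\<close> meet \<open>x = 0\<close> in \<open>(0, i)\<close> and \<open>(0, i + n)\<close>; hence
  the point determines \<open>i\<close> and \<open>n\<close> modulo \<open>p\<close>.
\<close>

lemma net_coordinates:
  assumes N: "net p A B D c" and prime: "prime p"
    and P: "P 0 = A" "\<And>n. net p (P n) (P (Suc n)) D c"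
  shows "coordinatized pts col p (\<lambda>x. P (nat (x mod p))) D c"
proof -
  have p: "p > 1"
    using prime prime_gt_1_int by blast
  have slope: "col (P 0 i) (P n (i + j * int n)) (D j)" for i j n
  proof (induction n)
    case 0
    show ?case using net_pts[OF P(2)] col_degenerate by simp
  next
    case (Suc n)
    have "P n (i + j * int n) \<noteq> D j"
      using netD(5)[OF P(2), of n "i + j * int n" j] netD(3)[OF N, of j j] by metis
    moreover have "col (P n (i + j * int n)) (P (Suc n) (i + j * int n + j)) (D j)"
      by (rule netD(10)[OF P(2)])
    moreover have "i + j * int n + j = i + j * int (Suc n)"
      by (simp add: algebra_simps)
    ultimately show ?case
      using Suc col_trans col_perms by metis
  qed
  have eq: "P n i = P n j \<longleftrightarrow> [i = j] (mod p)" for n i j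
    by (rule netD(7)[OF P(2)])
  have PD: "P n i \<noteq> D j" for n i j
    using netD(5)[OF P(2), of n i j] netD(3)[OF N, of j j] by metis
  have Pc: "P n i \<noteq> c" for n i
    using netD(5)[OF P(2), of n i 0] net_pts[OF N] col_degenerate by metis
  have Dc: "D j \<noteq> c" for j
    using netD(5)[OF N, of 0 j] net_pts[OF N] col_degenerate col_perms by metis
  have sep: "[i = i'] (mod p)"
    if "col (P 0 i) (P n u) (D j)" "col (P 0 i') (P n' u') (D j)" "P n u = P n' u'" for i i' j n n' u u'
  proof (rule ccontr)
    assume "\<not> [i = i'] (mod p)"
    then have ne: "P 0 i \<noteq> P 0 i'"
      using eq by blast
    have "col (P n u) (D j) c"
      using col_merge[of "P 0 i" "P 0 i'" "P n u" "D j" c] ne PD that netD(1)[OF P(2), of 0 i i'] col_perms by metis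
    then show False
      using netD(5)[OF P(2), of n u j] col_perms by blast
  qed
  have inj: "n = n' \<and> [i = i'] (mod p)"
    if e: "P n i = P n' i'" and n: "int n < p" "int n' < p" for n n' i i'
  proof -
    have 1: "[i = i'] (mod p)"
      using sep[of i n i 0 i' n' i'] slope[of i n 0] slope[of i' n' 0] e by simp
    have "[i + int n = i' + int n'] (mod p)"
      using sep[of "i + int n" n i "- 1" "i' + int n'" n' i']
        slope[of "i + int n" n "- 1"] slope[of "i' + int n'" n' "- 1"] e by simp
    then have "[int n = int n'] (mod p)"
      using cong_diff[OF _ 1, of "i + int n" "i' + int n'"] by simp
    then show ?thesis
      using 1 n unfolding cong_def by simp
  qed
  have "P (nat (x mod p)) y = P (nat (x' mod p)) y' \<longleftrightarrow> [x = x'] (mod p) \<and> [y = y'] (mod p)" for x x' y y'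
  proof
    assume "P (nat (x mod p)) y = P (nat (x' mod p)) y'"
    then have "nat (x mod p) = nat (x' mod p) \<and> [y = y'] (mod p)"
      by (rule inj) (use p in simp_all)
    then show "[x = x'] (mod p) \<and> [y = y'] (mod p)"
      using p unfolding cong_def by (simp add: eq_nat_nat_iff)
  next
    assume "[x = x'] (mod p) \<and> [y = y'] (mod p)"
    then show "P (nat (x mod p)) y = P (nat (x' mod p)) y'"
      using eq unfolding cong_def by metis
  qed
  moreover have "col (P 0 i) (P (nat (x mod p)) (i + j * x)) (D j)" for i j x
  proof -
    have "P (nat (x mod p)) (i + j * x) = P (nat (x mod p)) (i + j * (x mod p))"
      unfolding eq cong_def by (metis mod_add_right_eq mod_mult_right_eq)
    then show ?thesis
      using slope[of i "nat (x mod p)" j] p by simp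
  qed
  moreover have "P (nat (0 mod p)) = P 0"
    by simp
  ultimately show ?thesis
    by unfold_locales
      (use prime PD Pc Dc netD(1)[OF P(2)] netD(3,5,9)[OF N] P(1) in simp_all)
qed

end

section \<open>Integer triples modulo a prime\<close>

type_synonym triple = "int \<times> int \<times> int"

fun dot :: "triple \<Rightarrow> triple \<Rightarrow> int" where
  "dot (a, b, c) (x, y, z) = a * x + b * y + c * z"

fun cross :: "triple \<Rightarrow> triple \<Rightarrow> triple" where
  "cross (a, b, c) (x, y, z) = (b * z - c * y, c * x - a * z, a * y - b * x)"

definition det3 :: "triple \<Rightarrow> triple \<Rightarrow> triple \<Rightarrow> int" where
  "det3 u v w = dot (cross u v) w"

fun comb :: "triple \<Rightarrow> triple \<Rightarrow> triple \<Rightarrow> triple \<Rightarrow> triple" where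
  "comb (a, b, c) (d, e, f) (g, h, i) (x, y, z) =
     (x * a + y * d + z * g, x * b + y * e + z * h, x * c + y * f + z * i)"

fun zero_mod :: "int \<Rightarrow> triple \<Rightarrow> bool" where
  "zero_mod p (a, b, c) \<longleftrightarrow> p dvd a \<and> p dvd b \<and> p dvd c"

text \<open>
  Multiplicativity of the determinant. It allows collinearity to be computed in any frame.
\<close>

lemma det3_comb: "det3 (comb a b c u) (comb a b c v) (comb a b c w) = det3 a b c * det3 u v w"
  by (cases a; cases b; cases c; cases u; cases v; cases w) (simp add: det3_def algebra_simps)

lemma det3_perms:
  "det3 b a c = - det3 a b c" "det3 a c b = - det3 a b c" "det3 c b a = - det3 a b c"
  "det3 b c a = det3 a b c" "det3 c a b = det3 a b c"
  by (cases a; cases b; cases c; simp add: det3_def algebra_simps)+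

lemma det3_same: "det3 a a b = 0" "det3 a b a = 0" "det3 b a a = 0"
  by (cases a; cases b; simp add: det3_def algebra_simps)+

lemma det3_zero_mod:
  assumes "zero_mod p u"
  shows "p dvd det3 u v w"
  using assms by (cases u; cases v; cases w) (auto simp: det3_def intro!: dvd_add dvd_mult2 dvd_diff)

lemma dot_zero_mod: "zero_mod p u \<Longrightarrow> p dvd dot u v"
  by (cases u; cases v) auto

lemma inverse_mod_prime:
  fixes p :: int
  assumes "prime p" "\<not> p dvd z"
  obtains w where "p dvd z * w - 1"
proof -
  have "coprime z p"
    using assms by (simp add: coprime_commute prime_imp_coprime_int)
  then show thesis
    using that cong_solve_coprime_int[of z p] by (auto simp: cong_iff_dvd_diff)
qed

section \<open>Homogeneous coordinates\<close>

context coordinatized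
begin

definition inv_p :: "int \<Rightarrow> int" where
  "inv_p z = (SOME w. p dvd z * w - 1)"

lemma inv_p: "\<not> p dvd z \<Longrightarrow> p dvd z * inv_p z - 1"
  unfolding inv_p_def by (rule someI_ex) (meson inverse_mod_prime prime_p)

text \<open>The zero triple represents no point; the value \<open>c\<close> is a default there.\<close>

fun pt :: "triple \<Rightarrow> 'a" where
  "pt (x, y, z) =
     (if \<not> p dvd z then P (x * inv_p z) (y * inv_p z)
      else if \<not> p dvd x then D (y * inv_p x) else c)"

lemma prime_dvd_mult: "p dvd a * b \<longleftrightarrow> p dvd a \<or> p dvd b"
  using prime_p by (rule prime_dvd_mult_iff)

lemma ratio_eq_iff:
  assumes "\<not> p dvd z" "\<not> p dvd z'"
  shows "[x * inv_p z = x' * inv_p z'] (mod p) \<longleftrightarrow> p dvd x * z' - x' * z"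
proof -
  have z: "p dvd z * inv_p z - 1" "p dvd z' * inv_p z' - 1"
    using assms inv_p by blast+
  have "x * z' - x' * z = (x * inv_p z - x' * inv_p z') * (z * z')
      - x * z' * (z * inv_p z - 1) + x' * z * (z' * inv_p z' - 1)"
    by (simp add: algebra_simps)
  then have "p dvd x * z' - x' * z \<longleftrightarrow> p dvd (x * inv_p z - x' * inv_p z') * (z * z')"
    using z by (smt (verit, best) dvd_add_left_iff dvd_diff_right_iff dvd_mult minus_dvd_iff
        dvd_add_right_iff diff_conv_add_uminus)
  then show ?thesis
    using assms by (simp add: cong_iff_dvd_diff prime_dvd_mult)
qed

lemma pt_eq_iff:
  assumes "\<not> zero_mod p a" "\<not> zero_mod p b"
  shows "pt a = pt b \<longleftrightarrow> zero_mod p (cross a b)"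
proof -
  obtain x y z where a: "a = (x, y, z)" by (cases a)
  obtain x' y' z' where b: "b = (x', y', z')" by (cases b)
  consider "\<not> p dvd z" "\<not> p dvd z'" | "\<not> p dvd z" "p dvd z'" | "p dvd z" "\<not> p dvd z'"
    | "p dvd z" "p dvd z'" "\<not> p dvd x" "\<not> p dvd x'"
    | "p dvd z" "p dvd z'" "p dvd x \<or> p dvd x'"
    by blast
  then show ?thesis
  proof cases
    case 1
    have "p dvd x * y' - y * x'" if "p dvd x * z' - x' * z" "p dvd y * z' - y' * z"
    proof -
      have "z * (x * y' - y * x') = y * (x * z' - x' * z) - x * (y * z' - y' * z)"
        by (simp add: algebra_simps)
      then have "p dvd z * (x * y' - y * x')"
        using that by (metis dvd_diff dvd_mult)
      then show ?thesis using 1 prime_dvd_mult by blast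
    qed
    then show ?thesis
      using 1 unfolding a b
      by (auto simp: P_eq_iff ratio_eq_iff dvd_diff_commute mult.commute)
  next
    case 2
    then show ?thesis
      using assms P_not_D P_not_c unfolding a b
      by (auto simp: dvd_diff_left_iff dvd_diff_right_iff prime_dvd_mult)
  next
    case 3
    then show ?thesis
      using assms P_not_D[symmetric] P_not_c[symmetric] unfolding a b
      by (auto simp: dvd_diff_left_iff dvd_diff_right_iff prime_dvd_mult)
  next
    case 4
    then show ?thesis
      unfolding a b by (auto simp: D_eq_iff ratio_eq_iff dvd_diff_commute mult.commute)
  next
    case 5
    then show ?thesis
      using assms D_not_c D_not_c[symmetric] unfolding a b
      by (auto simp: dvd_diff_left_iff dvd_diff_right_iff prime_dvd_mult)
  qed
qed

text \<open>
  A linear form that is nonzero modulo \<open>p\<close> defines a line of slope \<open>- l / m\<close>, a vertical line, or the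
  line at infinity, according to which coefficients vanish.
\<close>

lemma form_line:
  assumes u: "\<not> zero_mod p u"
  obtains g h where "g \<noteq> h" "\<And>v. \<not> zero_mod p v \<Longrightarrow> p dvd dot u v \<Longrightarrow> col g h (pt v)"
proof -
  have P_pts: "P x y \<in> pts" and D_pts: "D i \<in> pts" and c_pts: "c \<in> pts" for x y i
    using vertical_line infinite_line col_pts by blast+
  obtain l m n where lmn: "u = (l, m, n)" by (cases u)
  consider "\<not> p dvd m" | "p dvd m" "\<not> p dvd l" | "p dvd m" "p dvd l" "\<not> p dvd n"
    using u lmn by auto
  then show thesis
  proof cases
    case 1
    define i j where "i = - n * inv_p m" and "j = - l * inv_p m"
    have m: "p dvd m * inv_p m - 1"
      using 1 by (rule inv_p)
    have "col (P 0 i) (D j) (pt v)" if v: "\<not> zero_mod p v" "p dvd dot u v" for v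
    proof -
      obtain x y z where xyz: "v = (x, y, z)" by (cases v)
      have F: "p dvd l * x + m * y + n * z"
        using v(2) unfolding xyz lmn by simp
      show ?thesis
      proof (cases "p dvd z")
        case True
        then have F: "p dvd l * x + m * y"
          using F by (simp add: dvd_add_left_iff)
        then have "\<not> p dvd x"
          using v(1) True 1 unfolding xyz by (auto simp: dvd_add_right_iff prime_dvd_mult)
        moreover have "[y * inv_p x = - l * inv_p m] (mod p)"
          using F ratio_eq_iff[OF \<open>\<not> p dvd x\<close> 1, of y "- l"] by (simp add: algebra_simps)
        ultimately have "pt v = D j"
          using True D_eq_iff unfolding xyz j_def by simp
        then show ?thesis
          using P_pts D_pts col_degenerate col_perms by metis
      next
        case False
        let ?w = "inv_p z"
        have "p dvd z * ?w - 1"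
          using False by (rule inv_p)
        moreover have "y * ?w - (i + j * (x * ?w)) = inv_p m * ?w * (l * x + m * y + n * z)
            - y * ?w * (m * inv_p m - 1) - n * inv_p m * (z * ?w - 1)"
          unfolding i_def j_def by (simp add: algebra_simps)
        ultimately have "p dvd y * ?w - (i + j * (x * ?w))"
          using F m by (simp add: dvd_diff dvd_mult)
        then have "pt v = P (x * ?w) (i + j * (x * ?w))"
          using False unfolding xyz by (simp add: P_eq_iff cong_iff_dvd_diff)
        then show ?thesis
          using sloped_line col_swap23 by metis
      qed
    qed
    then show thesis
      using that P_not_D by blast
  next
    case 2
    define k where "k = - n * inv_p l"
    have "col c (P k 0) (pt v)" if v: "\<not> zero_mod p v" "p dvd dot u v" for v
    proof -
      obtain x y z where xyz: "v = (x, y, z)" by (cases v)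
      have "p dvd (l * x + n * z) + m * y"
        using v(2) unfolding xyz lmn by (simp add: algebra_simps)
      then have F: "p dvd l * x + n * z"
        using 2 by (simp add: dvd_add_left_iff)
      show ?thesis
      proof (cases "p dvd z")
        case True
        then have "p dvd x"
          using F 2 by (simp add: dvd_add_left_iff prime_dvd_mult)
        then have "pt v = c"
          using True unfolding xyz by simp
        then show ?thesis
          using P_pts c_pts col_degenerate col_perms by metis
      next
        case False
        have "[x * inv_p z = - n * inv_p l] (mod p)"
          using F ratio_eq_iff[OF False 2(2), of x "- n"] by (simp add: algebra_simps)
        then have "pt v = P k (y * inv_p z)"
          using False unfolding xyz k_def by (simp add: P_eq_iff)
        then show ?thesis
          using vertical_line by metis
      qed
    qed
    then show thesis
      using that P_not_c by metis
  next
    case 3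
    have "col c (D 0) (pt v)" if v: "\<not> zero_mod p v" "p dvd dot u v" for v
    proof -
      obtain x y z where xyz: "v = (x, y, z)" by (cases v)
      have "p dvd n * z"
        using v(2) 3 unfolding xyz lmn by (simp add: dvd_add_right_iff)
      then have "p dvd z"
        using 3 prime_dvd_mult by blast
      then have "pt v = D (y * inv_p x) \<or> pt v = c"
        unfolding xyz by simp
      then show ?thesis
        using infinite_line D_pts c_pts col_degenerate col_perms by metis
    qed
    then show thesis
      using that D_not_c by metis
  qed
qed

lemma pt_in: "pt v \<in> pts"
proof -
  have "P x y \<in> pts" "D i \<in> pts" "c \<in> pts" for x y i
    using vertical_line infinite_line col_pts by blast+
  then show ?thesis by (cases v) simp
qed

lemma col_pt:
  assumes nz: "\<not> zero_mod p a" "\<not> zero_mod p b" "\<not> zero_mod p c'" and "p dvd det3 a b c'"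
  shows "col (pt a) (pt b) (pt c')"
proof (cases "zero_mod p (cross a b)")
  case True
  then show ?thesis
    using pt_eq_iff nz col_degenerate pt_in by metis
next
  case False
  then obtain g h where gh: "g \<noteq> h"
    "\<And>v. \<not> zero_mod p v \<Longrightarrow> p dvd dot (cross a b) v \<Longrightarrow> col g h (pt v)"
    using form_line by metis
  have "p dvd dot (cross a b) a" "p dvd dot (cross a b) b" "p dvd dot (cross a b) c'"
    using assms(4) det3_same(2)[of a b] det3_same(3)[of a b] unfolding det3_def by simp_all
  then show ?thesis
    using col_on_line[OF gh(1)] gh(2) nz by metis
qed

text \<open>
  A collinear triple of points with nonzero determinant would draw the whole plane onto one line:
  any other point \<open>d\<close> lies on a line of the coordinate plane which meets the first line twice,
  namely in \<open>a\<close> and in the point \<open>e\<close> where it crosses \<open>b c'\<close>.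
\<close>

lemma not_col_pt:
  assumes nz: "\<not> zero_mod p a" "\<not> zero_mod p b" "\<not> zero_mod p c'" and D: "\<not> p dvd det3 a b c'"
  shows "\<not> col (pt a) (pt b) (pt c')"
proof
  assume "col (pt a) (pt b) (pt c')"
  then have abc: "col (pt b) (pt c') (pt a)"
    using col_perms by blast
  have "\<not> zero_mod p (cross b c')"
    using D det3_perms(4)[of b c' a] dot_zero_mod unfolding det3_def by metis
  then have bc: "pt b \<noteq> pt c'"
    using pt_eq_iff nz by blast
  have all: "col (pt b) (pt c') (pt d)" if d: "\<not> zero_mod p d" for d
  proof (cases "zero_mod p (cross a d)")
    case True
    then show ?thesis
      using pt_eq_iff nz d abc by metis
  next
    case False
    define e where "e = comb a d (0, 0, 0) (det3 b c' d, - det3 b c' a, 0)"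
    have "cross a e = comb (0, 0, 0) (0, 0, 0) (cross a d) (0, 0, - det3 b c' a)"
      unfolding e_def by (cases a; cases d) (simp add: algebra_simps)
    moreover have "\<not> p dvd det3 b c' a"
      using D det3_perms(4) by metis
    ultimately have ae: "\<not> zero_mod p (cross a e)"
      using False by (cases "cross a d") (auto simp: prime_dvd_mult)
    have e: "\<not> zero_mod p e"
      using ae by (cases a; cases e) auto
    have "det3 b c' e = 0"
      unfolding e_def det3_def
      by (cases a; cases d; cases b; cases c') (simp add: algebra_simps)
    moreover have "det3 a e d = 0"
      unfolding e_def det3_def
      by (cases a; cases d; cases b; cases c') (simp add: algebra_simps)
    ultimately have "col (pt b) (pt c') (pt e)" "col (pt a) (pt e) (pt d)"
      using col_pt nz d e by (metis dvd_0_right)+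
    moreover have "pt a \<noteq> pt e"
      using ae pt_eq_iff nz e by blast
    ultimately show ?thesis
      using col_merge[OF _ bc abc] by blast
  qed
  have "\<not> p dvd 1"
    using prime_p not_prime_unit by blast
  then have "pt (0, 0, 1) = P 0 0" "pt (1, 0, 0) = D 0" "pt (0, 1, 0) = c"
    "\<not> zero_mod p (0, 0, 1)" "\<not> zero_mod p (1, 0, 0)" "\<not> zero_mod p (0, 1, 0)"
    by simp_all
  then show False
    using all col_on_line[OF bc] not_on_a_line by metis
qed

lemma pt_affine: "pt (x, y, 1) = P x y" and pt_infinite: "pt (1, j, 0) = D j"
  and pt_vertical: "pt (0, 1, 0) = c"
proof -
  have 1: "\<not> p dvd 1"
    using prime_p not_prime_unit by blast
  then have "[x * inv_p 1 = x] (mod p)" for x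
    using inv_p[OF 1] dvd_mult[of p "inv_p 1 - 1" x] by (simp add: cong_iff_dvd_diff algebra_simps)
  then show "pt (x, y, 1) = P x y" "pt (1, j, 0) = D j" "pt (0, 1, 0) = c"
    using 1 by (simp_all add: P_eq_iff D_eq_iff)
qed

end

section \<open>The plane carried by homogeneous coordinates\<close>

locale coordinate_plane = linear_space +
  fixes p :: int and pt :: "triple \<Rightarrow> 'a"
  assumes prime_p: "prime p"
    and pt_in: "pt v \<in> pts"
    and pt_eq_iff: "\<not> zero_mod p a \<Longrightarrow> \<not> zero_mod p b \<Longrightarrow> pt a = pt b \<longleftrightarrow> zero_mod p (cross a b)"
    and col_pt_iff: "\<not> zero_mod p a \<Longrightarrow> \<not> zero_mod p b \<Longrightarrow> \<not> zero_mod p c \<Longrightarrow>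
      col (pt a) (pt b) (pt c) \<longleftrightarrow> p dvd det3 a b c"
begin

definition plane :: "'a set" where
  "plane = pt ` {v. \<not> zero_mod p v}"

definition line :: "'a \<Rightarrow> 'a \<Rightarrow> 'a set" where
  "line a b = {c \<in> plane. col a b c}"

definition plane_lines :: "'a set set" where
  "plane_lines = {line a b | a b. a \<in> plane \<and> b \<in> plane \<and> a \<noteq> b}"

lemma planeE:
  assumes "x \<in> plane"
  obtains v where "\<not> zero_mod p v" "x = pt v"
  using assms unfolding plane_def by blast

lemma pt_plane: "\<not> zero_mod p v \<Longrightarrow> pt v \<in> plane"
  unfolding plane_def by blast

lemma plane_pts: "plane \<subseteq> pts"
  unfolding plane_def using pt_in by blast

lemma dvd_mult_iff: "p dvd a * b \<longleftrightarrow> p dvd a \<or> p dvd b"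
  using prime_p by (rule prime_dvd_mult_iff)

lemma not_dvd_one: "\<not> p dvd 1"
  using prime_p not_prime_unit by blast

lemma nonzero_of_det:
  assumes "\<not> p dvd det3 a b c"
  shows "\<not> zero_mod p a" "\<not> zero_mod p b" "\<not> zero_mod p c"
  using assms det3_zero_mod det3_perms(4,5) by metis+

lemma nonzero_comb:
  assumes D: "\<not> p dvd det3 a b c" and v: "\<not> zero_mod p v"
  shows "\<not> zero_mod p (comb a b c v)"
proof -
  obtain x y z where xyz: "v = (x, y, z)" by (cases v)
  have "det3 v (0, 1, 0) (0, 0, 1) = x" "det3 v (0, 0, 1) (1, 0, 0) = y"
    "det3 v (1, 0, 0) (0, 1, 0) = z"
    unfolding xyz det3_def by simp_all
  then obtain e f where "\<not> p dvd det3 v e f"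
    using v unfolding xyz by (metis zero_mod.simps)
  then have "\<not> p dvd det3 (comb a b c v) (comb a b c e) (comb a b c f)"
    using D unfolding det3_comb dvd_mult_iff by simp
  then show ?thesis
    by (rule nonzero_of_det)
qed

lemma col_comb_iff:
  assumes "\<not> p dvd det3 a b c" "\<not> zero_mod p u" "\<not> zero_mod p v" "\<not> zero_mod p w"
  shows "col (pt (comb a b c u)) (pt (comb a b c v)) (pt (comb a b c w)) \<longleftrightarrow> p dvd det3 u v w"
  using assms by (simp add: col_pt_iff nonzero_comb det3_comb dvd_mult_iff)

definition lin :: "triple \<Rightarrow> triple \<Rightarrow> int \<Rightarrow> int \<Rightarrow> triple" where
  "lin a b s t = comb a b (0, 0, 0) (s, t, 0)"

lemma lin_comb: "lin a b s t = comb a b c (s, t, 0)" "lin a b s t = comb a c b (s, 0, t)"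
  "lin a b s t = comb c a b (0, s, t)"
  unfolding lin_def by (cases a; cases b; cases c; simp)+

lemma det3_lin: "det3 a b (lin a b s t) = 0"
  unfolding lin_def det3_def by (cases a; cases b) (simp add: algebra_simps)

lemma zero_mod_cross_lin:
  assumes "\<not> zero_mod p (cross a b)"
  shows "zero_mod p (cross a (lin a b s t)) \<longleftrightarrow> p dvd t"
    "zero_mod p (cross b (lin a b s t)) \<longleftrightarrow> p dvd s"
proof -
  have "cross a (lin a b s t) = comb (0, 0, 0) (0, 0, 0) (cross a b) (0, 0, t)"
    "cross b (lin a b s t) = comb (0, 0, 0) (0, 0, 0) (cross a b) (0, 0, - s)"
    unfolding lin_def by (cases a; cases b; simp add: algebra_simps)+
  then show "zero_mod p (cross a (lin a b s t)) \<longleftrightarrow> p dvd t"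
    "zero_mod p (cross b (lin a b s t)) \<longleftrightarrow> p dvd s"
    using assms by (cases "cross a b"; auto simp: dvd_mult_iff)+
qed

lemma nonzero_lin:
  assumes "\<not> zero_mod p (cross a b)" "\<not> (p dvd s \<and> p dvd t)"
  shows "\<not> zero_mod p (lin a b s t)"
proof
  assume 0: "zero_mod p (lin a b s t)"
  have "zero_mod p (cross u (lin a b s t))" for u
    using 0 by (cases u; cases "lin a b s t") auto
  then show False
    using zero_mod_cross_lin[OF assms(1)] assms(2) by blast
qed

lemma frame:
  assumes "\<not> zero_mod p (cross a b)"
  obtains w where "\<not> p dvd det3 a b w"
proof -
  obtain x y z where xyz: "cross a b = (x, y, z)" by (cases "cross a b")
  have "dot (cross a b) (1, 0, 0) = x" "dot (cross a b) (0, 1, 0) = y" "dot (cross a b) (0, 0, 1) = z"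
    unfolding xyz by simp_all
  then show thesis
    using assms that unfolding xyz det3_def by (metis zero_mod.simps)
qed

text \<open>Cramer's rule for \<open>c\<close> in a frame \<open>a\<close>, \<open>b\<close>, \<open>w\<close>, multiplied by the determinant of the frame.\<close>

lemma point_on_line:
  assumes ab: "\<not> zero_mod p (cross a b)" and c: "\<not> zero_mod p c" and "p dvd det3 a b c"
  obtains s t where "\<not> zero_mod p (lin a b s t)" "pt c = pt (lin a b s t)"
proof -
  obtain w where w: "\<not> p dvd det3 a b w"
    using frame[OF ab] .
  let ?v = "lin a b (det3 c b w) (det3 a c w)"
  have v: "?v = comb c (0, 0, 0) w (det3 a b w, 0, - det3 a b c)"
    unfolding lin_def det3_def by (cases a; cases b; cases c; cases w) (simp add: algebra_simps)
  have "cross c ?v = comb (0, 0, 0) (0, 0, 0) (cross c w) (0, 0, - det3 a b c)"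
    unfolding v by (cases c; cases w) (simp add: algebra_simps)
  then have "zero_mod p (cross c ?v)"
    using assms(3) by (cases "cross c w") auto
  moreover have "\<not> zero_mod p ?v"
  proof
    assume 0: "zero_mod p ?v"
    obtain x y z where xyz: "c = (x, y, z)" by (cases c)
    obtain x' y' z' where w': "w = (x', y', z')" by (cases w)
    have "p dvd det3 a b w * x + - det3 a b c * x' \<and> p dvd det3 a b w * y + - det3 a b c * y' \<and>
      p dvd det3 a b w * z + - det3 a b c * z'"
      using 0[unfolded v] by (simp add: xyz w')
    moreover have "p dvd - det3 a b c * i" for i
      using assms(3) by simp
    ultimately have "p dvd det3 a b w * x \<and> p dvd det3 a b w * y \<and> p dvd det3 a b w * z"
      using dvd_add_left_iff by blast
    then show False
      using w c unfolding xyz by (simp add: dvd_mult_iff)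
  qed
  ultimately show thesis
    using that pt_eq_iff c by blast
qed

lemma line_eq:
  assumes "a \<in> plane" "b \<in> plane" "a \<noteq> b" "c \<in> line a b" "d \<in> line a b" "c \<noteq> d"
  shows "line a b = line c d"
proof -
  have "col a b c" "col a b d" using assms unfolding line_def by auto
  then have "col a b e \<longleftrightarrow> col c d e" for e
    using col_on_line[OF assms(3)] col_merge[OF assms(6,3)] by blast
  then show ?thesis unfolding line_def by auto
qed

lemma in_line:
  assumes "a \<in> plane" "b \<in> plane"
  shows "a \<in> line a b \<and> b \<in> line a b"
proof -
  have "col a b a" "col a b b"
    using assms col_degenerate plane_pts col_swap12 col_swap23 by (metis subsetD)+
  then show ?thesis
    using assms unfolding line_def by simp
qed

lemma basis_points:
  "\<not> zero_mod p (1, 0, 0)" "\<not> zero_mod p (0, 1, 0)" "\<not> zero_mod p (0, 0, 1)" "\<not> zero_mod p (1, 1, 1)"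
  using not_dvd_one by auto

text \<open>
  Besides \<open>pt a\<close>, every point of the line has a representative \<open>t a + b\<close>, and \<open>t\<close> is unique modulo
  \<open>p\<close>; this counts the points.
\<close>

lemma line_points:
  assumes nz: "\<not> zero_mod p a" "\<not> zero_mod p b" and ab: "\<not> zero_mod p (cross a b)"
  shows "line (pt a) (pt b) = insert (pt a) ((\<lambda>t. pt (lin a b t 1)) ` {0..<p})"
proof (intro subset_antisym subsetI)
  fix c assume "c \<in> line (pt a) (pt b)"
  then have "c \<in> plane" "col (pt a) (pt b) c"
    unfolding line_def by auto
  then obtain v where v: "\<not> zero_mod p v" "c = pt v" "p dvd det3 a b v"
    using nz col_pt_iff by (metis planeE)
  obtain s t where st: "\<not> zero_mod p (lin a b s t)" "c = pt (lin a b s t)"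
    using point_on_line[OF ab v(1,3)] v(2) by metis
  show "c \<in> insert (pt a) ((\<lambda>t. pt (lin a b t 1)) ` {0..<p})"
  proof (cases "p dvd t")
    case True
    then have "pt a = c"
      unfolding st(2) using pt_eq_iff[OF nz(1) st(1)] zero_mod_cross_lin[OF ab] by simp
    then show ?thesis by simp
  next
    case False
    then obtain w where w: "p dvd t * w - 1"
      using inverse_mod_prime prime_p by blast
    define m where "m = (s * w) mod p"
    have "p dvd s * w - m"
      unfolding m_def by (simp add: mod_eq_dvd_iff[symmetric])
    moreover have "s - t * m = t * (s * w - m) - s * (t * w - 1)"
      by (simp add: algebra_simps)
    ultimately have d: "p dvd s - t * m"
      using w by (metis dvd_diff dvd_mult)
    have "cross (lin a b s t) (lin a b m 1) =
        comb (0, 0, 0) (0, 0, 0) (cross a b) (0, 0, s - t * m)"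
      unfolding lin_def by (cases a; cases b) (simp add: algebra_simps)
    then have "zero_mod p (cross (lin a b s t) (lin a b m 1))"
      using d by (cases "cross a b") auto
    moreover have "\<not> zero_mod p (lin a b m 1)"
      using nonzero_lin[OF ab] not_dvd_one by simp
    ultimately have "c = pt (lin a b m 1)"
      using st pt_eq_iff by simp
    moreover have "m \<in> {0..<p}"
      using prime_gt_1_int[OF prime_p] unfolding m_def by simp
    ultimately show ?thesis by blast
  qed
next
  fix c assume "c \<in> insert (pt a) ((\<lambda>t. pt (lin a b t 1)) ` {0..<p})"
  moreover have "pt (lin a b t 1) \<in> line (pt a) (pt b)" for t
    using nonzero_lin[OF ab, of t 1] not_dvd_one pt_plane nz col_pt_iff
    by (simp add: line_def det3_lin)
  moreover have "pt a \<in> line (pt a) (pt b)"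
    using in_line pt_plane nz by blast
  ultimately show "c \<in> line (pt a) (pt b)" by blast
qed

lemma plane_order: "has_order plane_lines (nat p)"
  unfolding has_order_def
proof
  fix L assume "L \<in> plane_lines"
  then obtain a b where L: "\<not> zero_mod p a" "\<not> zero_mod p b" "pt a \<noteq> pt b" "L = line (pt a) (pt b)"
    unfolding plane_lines_def plane_def by blast
  have ab: "\<not> zero_mod p (cross a b)"
    using L pt_eq_iff by blast
  have nz: "\<not> zero_mod p (lin a b t 1)" for t
    using nonzero_lin[OF ab] not_dvd_one by simp
  have "inj_on (\<lambda>t. pt (lin a b t 1)) {0..<p}"
  proof (rule inj_onI)
    fix s t assume st: "s \<in> {0..<p}" "t \<in> {0..<p}" "pt (lin a b s 1) = pt (lin a b t 1)"
    have "cross (lin a b s 1) (lin a b t 1) = comb (0, 0, 0) (0, 0, 0) (cross a b) (0, 0, s - t)"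
      unfolding lin_def by (cases a; cases b) (simp add: algebra_simps)
    moreover have "zero_mod p (cross (lin a b s 1) (lin a b t 1))"
      using st(3) pt_eq_iff nz by blast
    ultimately have "p dvd s - t"
      using ab by (cases "cross a b") (auto simp: dvd_mult_iff)
    then have "s mod p = t mod p"
      by (simp add: mod_eq_dvd_iff)
    then show "s = t"
      using st by simp
  qed
  moreover have "pt a \<notin> (\<lambda>t. pt (lin a b t 1)) ` {0..<p}"
    using pt_eq_iff[OF L(1) nz] zero_mod_cross_lin(1)[OF ab] not_dvd_one by auto
  ultimately have "card L = nat p + 1"
    unfolding L(4) line_points[OF L(1,2) ab] by (simp add: card_image)
  moreover have "finite L"
    unfolding L(4) line_points[OF L(1,2) ab] by simp
  ultimately show "finite L \<and> card L = nat p + 1" by blast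
qed

lemma lines_meet:
  assumes L: "L \<in> plane_lines" "L' \<in> plane_lines" "L \<noteq> L'"
  shows "\<exists>!x. x \<in> L \<and> x \<in> L'"
proof -
  obtain a b where a: "\<not> zero_mod p a" "\<not> zero_mod p b" "pt a \<noteq> pt b" "L = line (pt a) (pt b)"
    using L(1) unfolding plane_lines_def plane_def by blast
  obtain c d where c: "\<not> zero_mod p c" "\<not> zero_mod p d" "pt c \<noteq> pt d" "L' = line (pt c) (pt d)"
    using L(2) unfolding plane_lines_def plane_def by blast
  have cd: "\<not> zero_mod p (cross c d)"
    using c pt_eq_iff by blast
  (* The vector product of the two lines, expanded in c and d. *)
  define e where "e = lin c d (det3 a b d) (- det3 a b c)"
  have "\<not> (p dvd det3 a b d \<and> p dvd - det3 a b c)"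
  proof
    assume "p dvd det3 a b d \<and> p dvd - det3 a b c"
    then have "pt c \<in> L" "pt d \<in> L"
      using a c pt_plane col_pt_iff unfolding line_def by auto
    then show False
      using line_eq[OF pt_plane pt_plane a(3), of "pt c" "pt d"] a c L(3) by auto
  qed
  then have e: "\<not> zero_mod p e"
    unfolding e_def by (rule nonzero_lin[OF cd])
  have "det3 a b e = 0"
    unfolding e_def lin_def det3_def
    by (cases a; cases b; cases c; cases d) (simp add: algebra_simps)
  moreover have "det3 c d e = 0"
    unfolding e_def by (rule det3_lin)
  ultimately have "pt e \<in> L \<and> pt e \<in> L'"
    using a c e pt_plane col_pt_iff unfolding line_def by auto
  moreover have "x = y" if "x \<in> L \<and> x \<in> L'" "y \<in> L \<and> y \<in> L'" for x y
    using line_eq[OF pt_plane pt_plane a(3), of x y] line_eq[OF pt_plane pt_plane c(3), of x y]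
      that a c L(3) by auto
  ultimately show ?thesis by blast
qed

lemma plane_projective: "projective_plane plane plane_lines"
proof -
  have 1: "\<exists>!L. L \<in> plane_lines \<and> a \<in> L \<and> b \<in> L" if ab: "a \<in> plane" "b \<in> plane" "a \<noteq> b" for a b
  proof (rule ex1I[of _ "line a b"])
    show "line a b \<in> plane_lines \<and> a \<in> line a b \<and> b \<in> line a b"
      using ab in_line unfolding plane_lines_def by blast
    fix L assume "L \<in> plane_lines \<and> a \<in> L \<and> b \<in> L"
    then show "L = line a b"
      using line_eq ab(3) unfolding plane_lines_def by blast
  qed
  define q1 q2 q3 q4 where "q1 = pt (1, 0, 0)" "q2 = pt (0, 1, 0)" "q3 = pt (0, 0, 1)"
    "q4 = pt (1, 1, 1)"
  note q = this
  define Q where "Q = {q1, q2, q3, q4}"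
  note b = basis_points
  have nc: "\<not> col q1 q2 q3" "\<not> col q1 q2 q4" "\<not> col q1 q3 q4" "\<not> col q2 q3 q4"
    unfolding q using not_dvd_one by (simp_all add: col_pt_iff[OF b(1) b(2) b(3)]
        col_pt_iff[OF b(1) b(2) b(4)] col_pt_iff[OF b(1) b(3) b(4)] col_pt_iff[OF b(2) b(3) b(4)]
        det3_def)
  note nc' = nc nc[THEN noncol_perms(1)] nc[THEN noncol_perms(2)] nc[THEN noncol_perms(3)]
    nc[THEN noncol_perms(4)] nc[THEN noncol_perms(5)]
  have Q: "Q \<subseteq> plane"
    unfolding Q_def q using b pt_plane by simp
  have "distinct [q1, q2, q3, q4]"
    using nc' col_degenerate Q plane_pts unfolding Q_def by (auto simp: subset_iff)
  then have card: "card Q = 4"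
    unfolding Q_def by simp
  have tri: "\<forall>u\<in>Q. \<forall>v\<in>Q. \<forall>w\<in>Q. distinct [u, v, w] \<longrightarrow> \<not> col u v w"
    unfolding Q_def by (simp add: nc')
  have "card (Q \<inter> L) \<le> 2" if L: "L \<in> plane_lines" for L
  proof (rule ccontr)
    assume "\<not> card (Q \<inter> L) \<le> 2"
    then obtain J where "J \<subseteq> Q \<inter> L" "card J = 3"
      by (metis One_nat_def Suc_1 not_less_eq_eq numeral_3_eq_3 obtain_subset_with_card_n)
    then obtain u v w where uvw: "{u, v, w} \<subseteq> Q \<inter> L" "distinct [u, v, w]"
      by (auto simp: card_3_iff)
    obtain a b where ab: "a \<noteq> b" "L = line a b"
      using L unfolding plane_lines_def by blast
    have "col a b u" "col a b v" "col a b w"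
      using uvw(1) unfolding ab(2) line_def by auto
    then have "col u v w"
      by (rule col_on_line[OF ab(1)])
    moreover have "u \<in> Q" "v \<in> Q" "w \<in> Q"
      using uvw(1) by auto
    ultimately show False
      using tri uvw(2) by blast
  qed
  with Q card have "\<exists>Q. Q \<subseteq> plane \<and> card Q = 4 \<and> (\<forall>L\<in>plane_lines. card (Q \<inter> L) \<le> 2)"
    by blast
  moreover have "\<forall>L\<in>plane_lines. L \<subseteq> plane"
    unfolding plane_lines_def line_def by blast
  ultimately show ?thesis
    unfolding projective_plane_def using 1 lines_meet by simp
qed

text \<open>
  The quadrangle is written down in a frame \<open>a\<close>, \<open>b\<close>, \<open>w\<close>, with \<open>a\<close> and \<open>b\<close> representing \<open>y\<close> and \<open>z\<close>:
  if \<open>x\<close> is \<open>(s, t, 0)\<close>, its vertices are \<open>(s, 0, 1)\<close>, \<open>(0, 0, 1)\<close>, \<open>(0, t, 1)\<close>, \<open>(s, t, 1)\<close>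
  and the fourth harmonic point is \<open>(s, -t, 0)\<close>.
\<close>

lemma fourth_harmonic:
  assumes "y \<in> plane" "x \<in> plane" "z \<in> plane" "distinct [y, x, z]" "col y x z"
  obtains o' q r s x' where "quad y x z o' q r s" "x' \<in> plane" "col y z x'" "col o' r x'"
proof -
  obtain a b c where abc: "\<not> zero_mod p a" "\<not> zero_mod p b" "\<not> zero_mod p c"
    and eq: "y = pt a" "z = pt b" "x = pt c"
    using assms(1-3) unfolding plane_def by blast
  have ab: "\<not> zero_mod p (cross a b)"
    using abc assms(4) pt_eq_iff unfolding eq by auto
  have "p dvd det3 a b c"
    using assms(5) abc col_swap23 col_pt_iff unfolding eq by blast
  then obtain s t where st: "\<not> zero_mod p (lin a b s t)" "x = pt (lin a b s t)"
    using point_on_line[OF ab abc(3)] eq(3) by metis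
  have s: "\<not> p dvd s" and t: "\<not> p dvd t"
    using zero_mod_cross_lin[OF ab, of s t] pt_eq_iff[OF abc(1) st(1)] pt_eq_iff[OF abc(2) st(1)]
      assms(4) st(2) unfolding eq by auto
  obtain w where w: "\<not> p dvd det3 a b w"
    using frame[OF ab] .
  define f where "f v = pt (comb a b w v)" for v
  have f: "y = f (1, 0, 0)" "z = f (0, 1, 0)" "x = f (s, t, 0)"
    unfolding f_def eq(1,2) st(2) lin_comb(1)[of a b s t w] by (cases a; cases b; cases w; simp)+
  have nz: "\<not> zero_mod p (s, 0, 1)" "\<not> zero_mod p (0, 0, 1)" "\<not> zero_mod p (0, t, 1)"
    "\<not> zero_mod p (s, t, 1)" "\<not> zero_mod p (s, - t, 0)" "\<not> zero_mod p (s, t, 0)"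
    "\<not> zero_mod p (1, 0, 0)" "\<not> zero_mod p (0, 1, 0)"
    using s not_dvd_one by auto
  have col: "col (f u) (f v) (f v') \<longleftrightarrow> p dvd det3 u v v'"
    if "\<not> zero_mod p u" "\<not> zero_mod p v" "\<not> zero_mod p v'" for u v v'
    unfolding f_def using col_comb_iff[OF w that] .
  have "quad y x z (f (s, 0, 1)) (f (0, 0, 1)) (f (0, t, 1)) (f (s, t, 1))"
    unfolding quad_def f using s t
    by (simp only: col[OF nz(1) nz(2) nz(3)] col[OF nz(1) nz(2) nz(4)] col[OF nz(1) nz(3) nz(4)]
        col[OF nz(2) nz(3) nz(4)] col[OF nz(7) nz(1) nz(2)] col[OF nz(7) nz(3) nz(4)]
        col[OF nz(8) nz(1) nz(4)] col[OF nz(8) nz(2) nz(3)] col[OF nz(6) nz(2) nz(4)]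
        col[OF nz(7) nz(6) nz(8)]) (simp add: det3_def dvd_mult_iff)
  moreover have "f (s, - t, 0) \<in> plane"
    unfolding f_def using nonzero_comb[OF w] nz pt_plane by blast
  moreover have "col y z (f (s, - t, 0))" "col (f (s, 0, 1)) (f (0, t, 1)) (f (s, - t, 0))"
    unfolding f by (simp_all only: col[OF nz(7) nz(8) nz(5)] col[OF nz(1) nz(3) nz(5)])
      (simp_all add: det3_def)
  ultimately show thesis by (rule that)
qed

lemma on_line_iff:
  assumes "a \<in> plane" "b \<in> plane" "c \<in> plane"
  shows "on_line plane_lines {a, b, c} \<longleftrightarrow> col a b c"
proof
  assume "on_line plane_lines {a, b, c}"
  then obtain u v where "u \<noteq> v" "{a, b, c} \<subseteq> line u v"
    unfolding on_line_def plane_lines_def by blast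
  then have "u \<noteq> v" "col u v a" "col u v b" "col u v c"
    unfolding line_def by auto
  then show "col a b c"
    by (rule col_on_line)
next
  assume abc: "col a b c"
  have line: "line u v \<in> plane_lines" if "u \<in> plane" "v \<in> plane" "u \<noteq> v" for u v
    using that unfolding plane_lines_def by blast
  consider "a \<noteq> b" | "a = b" "a \<noteq> c" | "a = b" "a = c" by blast
  then show "on_line plane_lines {a, b, c}"
  proof cases
    case 1
    then have "{a, b, c} \<subseteq> line a b"
      using assms abc in_line[of a b] unfolding line_def by simp
    then show ?thesis
      using line[OF assms(1,2) 1] unfolding on_line_def by blast
  next
    case 2
    then show ?thesis
      using line[OF assms(1,3)] in_line[OF assms(1,3)] unfolding on_line_def by blast
  next
    case 3
    have "pt (1, 0, 0) \<noteq> pt (0, 1, 0)"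
      using pt_eq_iff[OF basis_points(1,2)] not_dvd_one by simp
    then obtain d where d: "d \<in> plane" "a \<noteq> d"
      using pt_plane[OF basis_points(1)] pt_plane[OF basis_points(2)] by metis
    then show ?thesis
      using 3 line[OF assms(1) d] in_line[OF assms(1) d(1)] unfolding on_line_def by blast
  qed
qed

text \<open>The sides \<open>a1 a2\<close> and \<open>b1 b2\<close> of two triangles in perspective from \<open>u\<close> meet only once.\<close>

lemma perspective_sides:
  assumes "a1 \<noteq> b1" "b1 \<noteq> u" "col u a1 b1" "col u a2 b2" "\<not> col u a1 a2"
    and "col a1 a2 c" "col b1 b2 c" "col a1 a2 d" "col b1 b2 d"
  shows "c = d"
proof (rule ccontr)
  assume cd: "c \<noteq> d"
  have pts: "u \<in> pts" "a1 \<in> pts" "a2 \<in> pts" "b1 \<in> pts" "b2 \<in> pts"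
    using assms(3,4) col_pts by blast+
  have a: "a1 \<noteq> a2"
    using assms(5) pts col_degenerate col_perms by metis
  have b: "b1 \<noteq> b2"
  proof
    assume "b1 = b2"
    then have "col u b1 a1" "col u b1 a2"
      using assms(3,4) col_swap23 by blast+
    then show False
      using col_trans[of u b1 a1 a2] assms(2,5) by blast
  qed
  have on: "col a1 a2 a1" "col a1 a2 a2" "col b1 b2 b1" "col b1 b2 b2"
    using pts col_degenerate col_perms by metis+
  have "col c d a1" "col c d a2" "col c d b1"
    using col_on_line[OF a assms(6,8)] col_on_line[OF b assms(7,9)] on by blast+
  then have "col a1 b1 a2"
    using col_on_line[OF cd] by blast
  moreover have "col a1 b1 u"
    using assms(3) col_perms by blast
  ultimately have "col a1 a2 u"
    using col_trans[OF assms(1)] by blast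
  then show False
    using assms(5) col_perms by blast
qed

text \<open>
  If \<open>b\<^sub>i\<close> is represented by \<open>s\<^sub>i u + t\<^sub>i a\<^sub>i\<close>, then the side \<open>b\<^sub>i b\<^sub>j\<close> contains the point
  \<open>s\<^sub>j b\<^sub>i - s\<^sub>i b\<^sub>j = s\<^sub>j t\<^sub>i a\<^sub>i - s\<^sub>i t\<^sub>j a\<^sub>j\<close> of the side \<open>a\<^sub>i a\<^sub>j\<close>, which is therefore \<open>c\<^sub>i\<^sub>j\<close>. These
  three triples are linearly dependent.
\<close>

lemma desargues_theorem:
  assumes pl: "u \<in> plane" "a1 \<in> plane" "a2 \<in> plane" "a3 \<in> plane" "b1 \<in> plane" "b2 \<in> plane"
      "b3 \<in> plane" "c12 \<in> plane" "c13 \<in> plane" "c23 \<in> plane"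
    and ne: "u \<notin> {a1, a2, a3, b1, b2, b3}" "a1 \<noteq> b1" "a2 \<noteq> b2" "a3 \<noteq> b3"
    and l: "col u a1 b1" "col u a2 b2" "col u a3 b3"
    and n: "\<not> col u a1 a2" "\<not> col u a1 a3" "\<not> col u a2 a3" "\<not> col a1 a2 a3"
    and c: "col a1 a2 c12" "col b1 b2 c12" "col a1 a3 c13" "col b1 b3 c13" "col a2 a3 c23"
      "col b2 b3 c23"
  shows "col c12 c13 c23"
proof -
  have rep: "\<exists>s t. \<not> p dvd s \<and> \<not> p dvd t \<and> \<not> zero_mod p (lin u a s t) \<and> b = pt (lin u a s t)"
    if h: "\<not> zero_mod p u" "\<not> zero_mod p a" "b \<in> plane" "pt u \<noteq> pt a" "col (pt u) (pt a) b"
      "pt u \<noteq> b" "pt a \<noteq> b" for u a b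
  proof -
    obtain v where v: "\<not> zero_mod p v" "b = pt v"
      using h(3) by (rule planeE)
    have ua: "\<not> zero_mod p (cross u a)"
      using h(1,2,4) pt_eq_iff by blast
    have "p dvd det3 u a v"
      using h(1,2,5) v col_pt_iff by blast
    then obtain s t where st: "\<not> zero_mod p (lin u a s t)" "b = pt (lin u a s t)"
      using point_on_line[OF ua v(1)] v(2) by metis
    then show ?thesis
      using zero_mod_cross_lin[OF ua, of s t] pt_eq_iff[OF h(1) st(1)]
        pt_eq_iff[OF h(2) st(1)] h(6,7) by metis
  qed
  have side: "c = pt (lin a a' (s' * t) (- (s * t')))"
    if "\<not> zero_mod p u" "\<not> zero_mod p a" "\<not> zero_mod p a'" "c \<in> plane"
      and st: "\<not> p dvd s" "\<not> p dvd t" "\<not> p dvd s'" "\<not> p dvd t'"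
      and b: "\<not> zero_mod p (lin u a s t)" "\<not> zero_mod p (lin u a' s' t')"
      and "pt a \<noteq> pt (lin u a s t)" "pt u \<noteq> pt (lin u a s t)" "\<not> col (pt u) (pt a) (pt a')"
      and "col (pt a) (pt a') c" "col (pt (lin u a s t)) (pt (lin u a' s' t')) c"
    for u a a' c s t s' t'
  proof -
    define d where "d = lin a a' (s' * t) (- (s * t'))"
    have "pt a \<noteq> pt a'"
      using that(3,13) pt_in col_degenerate col_perms by metis
    then have "\<not> zero_mod p (cross a a')"
      using that(2,3) pt_eq_iff by blast
    then have d: "\<not> zero_mod p d"
      unfolding d_def by (rule nonzero_lin) (use st in \<open>simp add: dvd_mult_iff\<close>)
    have "d = lin (lin u a s t) (lin u a' s' t') s' (- s)"
      unfolding d_def lin_def by (cases u; cases a; cases a') (simp add: algebra_simps)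
    then have "det3 (lin u a s t) (lin u a' s' t') d = 0"
      using det3_lin by simp
    moreover have "det3 a a' d = 0"
      unfolding d_def by (rule det3_lin)
    ultimately have "col (pt a) (pt a') (pt d)" "col (pt (lin u a s t)) (pt (lin u a' s' t')) (pt d)"
      using that(2,3) b d col_pt_iff by simp_all
    moreover have "col (pt u) (pt a) (pt (lin u a s t))" "col (pt u) (pt a') (pt (lin u a' s' t'))"
      using that(1,2,3) b col_pt_iff det3_lin by simp_all
    ultimately show ?thesis
      unfolding d_def[symmetric] using perspective_sides[of "pt a" "pt (lin u a s t)" "pt u" "pt a'"] that
      by metis
  qed
  obtain U where U: "\<not> zero_mod p U" "u = pt U" using pl(1) by (rule planeE)
  obtain A1 where A1: "\<not> zero_mod p A1" "a1 = pt A1" using pl(2) by (rule planeE)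
  obtain A2 where A2: "\<not> zero_mod p A2" "a2 = pt A2" using pl(3) by (rule planeE)
  obtain A3 where A3: "\<not> zero_mod p A3" "a3 = pt A3" using pl(4) by (rule planeE)
  obtain s1 t1 where 1: "\<not> p dvd s1" "\<not> p dvd t1" "\<not> zero_mod p (lin U A1 s1 t1)"
    "b1 = pt (lin U A1 s1 t1)"
    using rep[of U A1 b1] U A1 pl ne l by auto
  obtain s2 t2 where 2: "\<not> p dvd s2" "\<not> p dvd t2" "\<not> zero_mod p (lin U A2 s2 t2)"
    "b2 = pt (lin U A2 s2 t2)"
    using rep[of U A2 b2] U A2 pl ne l by auto
  obtain s3 t3 where 3: "\<not> p dvd s3" "\<not> p dvd t3" "\<not> zero_mod p (lin U A3 s3 t3)"
    "b3 = pt (lin U A3 s3 t3)"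
    using rep[of U A3 b3] U A3 pl ne l by auto
  have c12: "c12 = pt (lin A1 A2 (s2 * t1) (- (s1 * t2)))"
    by (rule side[OF U(1) A1(1) A2(1) pl(8) 1(1,2) 2(1,2) 1(3) 2(3)])
      (use ne n c U A1 A2 1 2 in auto)
  have c13: "c13 = pt (lin A1 A3 (s3 * t1) (- (s1 * t3)))"
    by (rule side[OF U(1) A1(1) A3(1) pl(9) 1(1,2) 3(1,2) 1(3) 3(3)])
      (use ne n c U A1 A3 1 3 in auto)
  have c23: "c23 = pt (lin A2 A3 (s3 * t2) (- (s2 * t3)))"
    by (rule side[OF U(1) A2(1) A3(1) pl(10) 2(1,2) 3(1,2) 2(3) 3(3)])
      (use ne n c U A2 A3 2 3 in auto)
  have D: "\<not> p dvd det3 A1 A2 A3"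
    using n(4) A1 A2 A3 col_pt_iff by blast
  show ?thesis
    unfolding c12 c13 c23 lin_comb(1)[of A1 A2 _ _ A3] lin_comb(2)[of A1 A3 _ _ A2]
      lin_comb(3)[of A2 A3 _ _ A1]
    by (subst col_comb_iff[OF D])
      (use 1(1,2) 2(1,2) 3(1,2) in \<open>auto simp: dvd_mult_iff det3_def algebra_simps\<close>)
qed

lemma plane_desarguesian: "desarguesian plane plane_lines"
proof -
  (* The long premise comes first, since it determines all ten points when the rule is applied. *)
  have d: "on_line plane_lines {c12, c13, c23}"
    if H: "u \<notin> {a1, a2, a3, b1, b2, b3} \<and> a1 \<noteq> b1 \<and> a2 \<noteq> b2 \<and> a3 \<noteq> b3 \<and>
        on_line plane_lines {u, a1, b1} \<and> on_line plane_lines {u, a2, b2} \<and>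
        on_line plane_lines {u, a3, b3} \<and>
        \<not> on_line plane_lines {u, a1, a2} \<and> \<not> on_line plane_lines {u, a1, a3} \<and>
        \<not> on_line plane_lines {u, a2, a3} \<and>
        \<not> on_line plane_lines {a1, a2, a3} \<and> \<not> on_line plane_lines {b1, b2, b3} \<and>
        on_line plane_lines {a1, a2, c12} \<and> on_line plane_lines {b1, b2, c12} \<and>
        on_line plane_lines {a1, a3, c13} \<and> on_line plane_lines {b1, b3, c13} \<and>
        on_line plane_lines {a2, a3, c23} \<and> on_line plane_lines {b2, b3, c23}"
      and pl: "u \<in> plane" "a1 \<in> plane" "a2 \<in> plane" "a3 \<in> plane" "b1 \<in> plane" "b2 \<in> plane"
        "b3 \<in> plane" "c12 \<in> plane" "c13 \<in> plane" "c23 \<in> plane"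
    for u a1 a2 a3 b1 b2 b3 c12 c13 c23
  proof -
    note on = on_line_iff[OF pl(1,2,5)] on_line_iff[OF pl(1,3,6)] on_line_iff[OF pl(1,4,7)]
      on_line_iff[OF pl(1,2,3)] on_line_iff[OF pl(1,2,4)] on_line_iff[OF pl(1,3,4)]
      on_line_iff[OF pl(2,3,4)] on_line_iff[OF pl(2,3,8)] on_line_iff[OF pl(5,6,8)]
      on_line_iff[OF pl(2,4,9)] on_line_iff[OF pl(5,7,9)] on_line_iff[OF pl(3,4,10)]
      on_line_iff[OF pl(6,7,10)] on_line_iff[OF pl(8,9,10)]
    show ?thesis
      unfolding on
      by (rule desargues_theorem[OF pl]) (use H[unfolded on] in simp_all)
  qed
  show ?thesis
    unfolding desarguesian_def by (intro ballI impI) (rule d, assumption, assumption+)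
qed

end

section \<open>Harmonic closure\<close>

text \<open>
  Any quadrangle gives \<open>HP\<close>, so the axioms of a harmonic matroid become statements about
  collinear triples.
\<close>

lemma harmonic_matroid_space:
  assumes "harmonic_matroid M"
  shows "harmonic_space (ground M) (collinear3 M)"
proof -
  have M: "simple_matroid M"
    using assms unfolding harmonic_matroid_def by blast
  interpret linear_space "ground M" "collinear3 M"
    by (rule simple_matroid_linear_space[OF M])
  have meet: "\<exists>x'. cl M {y, z} \<inter> cl M {o', r} = {x'}" if "HP M y x z o' q r s" for y x z o' q r s
    using assms that unfolding harmonic_matroid_def by blast
  have unique: "x' = x''" if "harmonic_conj M y z x x'" "harmonic_conj M y z x x''" for y z x x' x''
    using assms that unfolding harmonic_matroid_def by blast
  have cls: "cl M {y, z} \<inter> cl M {o', r} = {e. collinear3 M y z e \<and> collinear3 M o' r e}"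
    if Q: "quad y x z o' q r s" for y x z o' q r s
  proof -
    have "y \<noteq> z" "o' \<noteq> r"
      using quad_distinct[OF Q] by auto
    moreover have "y \<in> ground M" "z \<in> ground M" "o' \<in> ground M" "r \<in> ground M"
      using Q col_pts unfolding quad_def by blast+
    ultimately show ?thesis
      using cl_pair[OF M] by auto
  qed
  have conj: "harmonic_conj M y z x x'"
    if Q: "quad y x z o' q r s" "collinear3 M y z x'" "collinear3 M o' r x'" for y x z o' q r s x'
  proof -
    obtain e where "cl M {y, z} \<inter> cl M {o', r} = {e}"
      using meet[OF quad_HP[OF M Q(1)]] by blast
    then have "cl M {y, z} \<inter> cl M {o', r} = {x'}"
      using Q(2,3) cls[OF Q(1)] by auto
    then show ?thesis
      using quad_HP[OF M Q(1)] unfolding harmonic_conj_def by blast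
  qed
  show ?thesis
  proof
    show "\<exists>x'. collinear3 M y z x' \<and> collinear3 M o' r x'" if "quad y x z o' q r s" for y x z o' q r s
      using meet[OF quad_HP[OF M that]] cls[OF that] by auto
    show "x' = x''"
      if "quad y x z o' q r s" "quad y x z o'' q' r' s'" "collinear3 M y z x'" "collinear3 M o' r x'"
        "collinear3 M y z x''" "collinear3 M o'' r' x''" for y x z o' q r s o'' q' r' s' x' x''
      using unique conj[OF that(1,3,4)] conj[OF that(2,5,6)] by blast
  qed
qed

lemma hconj_harmonic_conj:
  assumes H: "harmonic_matroid M" and c: "harmonic_space.hconj (collinear3 M) y z x x'"
  shows "harmonic_conj M y z x x'"
proof -
  have M: "simple_matroid M"
    using H unfolding harmonic_matroid_def by blast
  interpret harmonic_space "ground M" "collinear3 M"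
    by (rule harmonic_matroid_space[OF H])
  obtain o' q r s where Q: "quad y x z o' q r s" "collinear3 M y z x'" "collinear3 M o' r x'"
    using c unfolding hconj_def by blast
  have hp: "HP M y x z o' q r s"
    by (rule quad_HP[OF M Q(1)])
  then obtain e where e: "cl M {y, z} \<inter> cl M {o', r} = {e}"
    using H unfolding harmonic_matroid_def by blast
  have "y \<noteq> z" "o' \<noteq> r"
    using quad_distinct[OF Q(1)] by auto
  moreover have "y \<in> ground M" "z \<in> ground M" "o' \<in> ground M" "r \<in> ground M"
    using Q(1) col_pts unfolding quad_def by blast+
  ultimately have "x' \<in> cl M {y, z} \<inter> cl M {o', r}"
    using cl_pair[OF M] Q(2,3) by auto
  then show ?thesis
    using hp e unfolding harmonic_conj_def by auto
qed

lemma harm_mono_index: "m \<le> n \<Longrightarrow> (harm M ^^ m) S \<subseteq> (harm M ^^ n) S"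
  by (rule lift_Suc_mono_le[of "\<lambda>n. (harm M ^^ n) S"]) (auto simp: harm_def)

lemma harmonic_closure_base: "S \<subseteq> harmonic_closure M S"
  unfolding harmonic_closure_def by (metis UN_upper UNIV_I funpow_0)

lemma harmonic_closure_closed:
  assumes "a \<in> harmonic_closure M S" "b \<in> harmonic_closure M S" "c \<in> harmonic_closure M S"
    and x: "harmonic_conj M a c b x"
  shows "x \<in> harmonic_closure M S"
proof -
  obtain i j k where "a \<in> (harm M ^^ i) S" "b \<in> (harm M ^^ j) S" "c \<in> (harm M ^^ k) S"
    using assms unfolding harmonic_closure_def by blast
  then have "a \<in> (harm M ^^ (i + j + k)) S" "b \<in> (harm M ^^ (i + j + k)) S"
      "c \<in> (harm M ^^ (i + j + k)) S"
    using harm_mono_index[of i "i + j + k" M S] harm_mono_index[of j "i + j + k" M S]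
      harm_mono_index[of k "i + j + k" M S] by auto
  moreover have "x \<in> ground M"
    using x unfolding harmonic_conj_def cl_def by blast
  ultimately have "x \<in> (harm M ^^ Suc (i + j + k)) S"
    using x unfolding harm_def by auto
  then show ?thesis
    unfolding harmonic_closure_def by blast
qed

lemma harmonic_closure_least:
  assumes "S \<subseteq> T"
    and closed: "\<And>a b c x. a \<in> T \<Longrightarrow> b \<in> T \<Longrightarrow> c \<in> T \<Longrightarrow> harmonic_conj M a c b x \<Longrightarrow> x \<in> T"
  shows "harmonic_closure M S \<subseteq> T"
proof -
  have "(harm M ^^ n) S \<subseteq> T" for n
  proof (induction n)
    case 0
    then show ?case using assms(1) by simp
  next
    case (Suc n)
    show ?case
    proof
      fix x assume "x \<in> (harm M ^^ Suc n) S"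
      then have "x \<in> harm M ((harm M ^^ n) S)"
        by simp
      then consider "x \<in> (harm M ^^ n) S"
        | a b c where "a \<in> (harm M ^^ n) S" "b \<in> (harm M ^^ n) S" "c \<in> (harm M ^^ n) S"
          "harmonic_conj M a c b x"
        unfolding harm_def by blast
      then show "x \<in> T"
      proof cases
        case 1
        then show ?thesis using Suc.IH by blast
      next
        case 2
        then show ?thesis using Suc.IH closed[of a b c x] by blast
      qed
    qed
  qed
  then show ?thesis
    unfolding harmonic_closure_def by blast
qed

section \<open>The matroid \<open>L\<^sub>p\<close> as a net\<close>

fun hpoint :: "nat \<Rightarrow> triple \<Rightarrow> triple set" where
  "hpoint p (a, b, c) = hom_point p a b c"

lemma hom_point_mod:
  assumes "[b = b'] (mod int p)"
  shows "hom_point p a b c = hom_point p a b' c"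
proof -
  have "(t * b) mod int p = (t * b') mod int p" for t
    using assms by (metis cong_def cong_scalar_left)
  then show ?thesis
    unfolding hom_point_def by simp
qed

lemma hpoint_eqD:
  assumes "hpoint p u = hpoint p v"
  shows "zero_mod (int p) (cross u v)"
proof -
  obtain a b c where u: "u = (a, b, c)" by (cases u)
  obtain a' b' c' where v: "v = (a', b', c')" by (cases v)
  have "((1 * a) mod int p, (1 * b) mod int p, (1 * c) mod int p) \<in> hpoint p u"
    unfolding u hpoint.simps hom_point_def by blast
  then obtain t where t: "int p dvd a - t * a'" "int p dvd b - t * b'" "int p dvd c - t * c'"
    unfolding assms unfolding v hpoint.simps hom_point_def by (auto simp: mod_eq_dvd_iff)
  have "int p dvd x * y' - y * x'" if "int p dvd x - t * x'" "int p dvd y - t * y'" for x y x' y'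
  proof -
    have "x * y' - y * x' = (x - t * x') * y' - (y - t * y') * x'"
      by (simp add: algebra_simps)
    then show ?thesis
      using that by (simp only: dvd_diff dvd_mult2)
  qed
  then show ?thesis
    using t unfolding u v by simp
qed

lemma PG2_ground: "\<not> zero_mod (int p) v \<Longrightarrow> hpoint p v \<in> ground (PG2 p)"
  unfolding PG2_def Let_def by (cases v) auto

lemma sum_triple: "distinct [x, y, z] \<Longrightarrow> sum f {x, y, z} = f x + (f y + f z)"
  by auto

lemma cong_sum_mod: "[a mod m + (b mod m + c mod m) = 0] (mod m) \<longleftrightarrow> m dvd a + b + c" for m :: int
proof -
  have "(a mod m + (b mod m + c mod m)) mod m = (a + (b + c)) mod m"
    by (intro mod_add_cong) simp_all
  then show ?thesis
    unfolding cong_def dvd_eq_mod_eq_0 by (simp add: add.assoc)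
qed

text \<open>
  The relation \<open>s u + t v + w = 0\<close> provides vectors in the three one-dimensional subspaces that add up
  to zero, and the one in the subspace of \<open>w\<close> is not zero.
\<close>

lemma PG2_dependent:
  assumes d: "distinct [hpoint p u, hpoint p v, hpoint p w]" and w: "\<not> zero_mod (int p) w"
    and z: "zero_mod (int p) (comb u v w (s, t, 1))"
  shows "\<not> indep (PG2 p) {hpoint p u, hpoint p v, hpoint p w}"
proof
  assume i: "indep (PG2 p) {hpoint p u, hpoint p v, hpoint p w}"
  obtain u1 u2 u3 where u: "u = (u1, u2, u3)" by (cases u)
  obtain v1 v2 v3 where v: "v = (v1, v2, v3)" by (cases v)
  obtain w1 w2 w3 where w': "w = (w1, w2, w3)" by (cases w)
  let ?m = "\<lambda>t (a, b, c). ((t * a) mod int p, (t * b) mod int p, (t * c) mod int p)"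
  define g where "g Q = (if Q = hpoint p u then ?m s u else if Q = hpoint p v then ?m t v else ?m 1 w)" for Q
  have g': "g (hpoint p u) = ((s * u1) mod int p, (s * u2) mod int p, (s * u3) mod int p)"
    "g (hpoint p v) = ((t * v1) mod int p, (t * v2) mod int p, (t * v3) mod int p)"
    "g (hpoint p w) = ((1 * w1) mod int p, (1 * w2) mod int p, (1 * w3) mod int p)"
    using d unfolding g_def u v w' by auto
  have mem: "?m k x \<in> hpoint p x" for k x
    by (cases x) (auto simp: hom_point_def)
  have "\<forall>Q\<in>{hpoint p u, hpoint p v, hpoint p w}. g Q \<in> Q"
    unfolding g_def using mem[of s u] mem[of t v] mem[of 1 w] by auto
  moreover have "[(\<Sum>Q\<in>{hpoint p u, hpoint p v, hpoint p w}. fst (g Q)) = 0] (mod int p)"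
    "[(\<Sum>Q\<in>{hpoint p u, hpoint p v, hpoint p w}. fst (snd (g Q))) = 0] (mod int p)"
    "[(\<Sum>Q\<in>{hpoint p u, hpoint p v, hpoint p w}. snd (snd (g Q))) = 0] (mod int p)"
    unfolding sum_triple[OF d] g' fst_conv snd_conv cong_sum_mod
    using z unfolding u v w' by simp_all
  ultimately have "\<forall>Q\<in>{hpoint p u, hpoint p v, hpoint p w}. g Q = (0, 0, 0)"
    using i unfolding PG2_def Let_def by (simp only: matroid_struct.simps) blast
  then have "g (hpoint p w) = (0, 0, 0)" by blast
  then show False
    using w unfolding g' unfolding w' by (auto simp: dvd_eq_mod_eq_0)
qed

text \<open>
  If \<open>a u + b v + c w\<close> vanishes, then so does every determinant of it with two other combinations of
  \<open>u\<close>, \<open>v\<close>, \<open>w\<close>; taking out the factor \<open>det3 u v w\<close>, this leaves \<open>a\<close>, \<open>b\<close> and \<open>c\<close>.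
\<close>

lemma PG2_independent:
  assumes p: "prime p" and D: "\<not> int p dvd det3 u v w"
  shows "distinct [hpoint p u, hpoint p v, hpoint p w]"
    and "indep (PG2 p) {hpoint p u, hpoint p v, hpoint p w}"
proof -
  have ne: "hpoint p x \<noteq> hpoint p y" if "\<not> int p dvd det3 x y z" for x y z
    using that dot_zero_mod[OF hpoint_eqD] unfolding det3_def by blast
  have "hpoint p v \<noteq> hpoint p w"
    by (rule ne[of v w u]) (use D in \<open>simp add: det3_perms(4)[of v w u]\<close>)
  moreover have "hpoint p u \<noteq> hpoint p w"
    by (rule ne[of u w v]) (use D in \<open>simp add: det3_perms(2)[of u w v]\<close>)
  ultimately show d: "distinct [hpoint p u, hpoint p v, hpoint p w]"
    using ne[OF D] by (simp del: hpoint.simps)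
  obtain u1 u2 u3 where u: "u = (u1, u2, u3)" by (cases u)
  obtain v1 v2 v3 where v: "v = (v1, v2, v3)" by (cases v)
  obtain w1 w2 w3 where w: "w = (w1, w2, w3)" by (cases w)
  have nz: "\<not> zero_mod (int p) u" "\<not> zero_mod (int p) v" "\<not> zero_mod (int p) w"
    using D det3_zero_mod det3_perms(4,5) by metis+
  have "g Q = (0, 0, 0)"
    if g: "\<forall>Q\<in>{hpoint p u, hpoint p v, hpoint p w}. g Q \<in> Q"
      and s: "[(\<Sum>Q\<in>{hpoint p u, hpoint p v, hpoint p w}. fst (g Q)) = 0] (mod int p)"
        "[(\<Sum>Q\<in>{hpoint p u, hpoint p v, hpoint p w}. fst (snd (g Q))) = 0] (mod int p)"
        "[(\<Sum>Q\<in>{hpoint p u, hpoint p v, hpoint p w}. snd (snd (g Q))) = 0] (mod int p)"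
      and Q: "Q \<in> {hpoint p u, hpoint p v, hpoint p w}" for g Q
  proof -
    obtain a where a: "g (hpoint p u) = ((a * u1) mod int p, (a * u2) mod int p, (a * u3) mod int p)"
      using g unfolding u by (auto simp: hom_point_def)
    obtain b where b: "g (hpoint p v) = ((b * v1) mod int p, (b * v2) mod int p, (b * v3) mod int p)"
      using g unfolding v by (auto simp: hom_point_def)
    obtain c where c: "g (hpoint p w) = ((c * w1) mod int p, (c * w2) mod int p, (c * w3) mod int p)"
      using g unfolding w by (auto simp: hom_point_def)
    have 1: "int p dvd a * u1 + b * v1 + c * w1" "int p dvd a * u2 + b * v2 + c * w2"
      "int p dvd a * u3 + b * v3 + c * w3"
      using s unfolding sum_triple[OF d] a b c fst_conv snd_conv cong_sum_mod by simp_all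
    have "zero_mod (int p) (comb u v w (a, b, c))"
      using 1 unfolding u v w by simp
    then have "int p dvd det3 (comb u v w (a, b, c)) (comb u v w x) (comb u v w y)" for x y
      by (rule det3_zero_mod)
    then have "int p dvd det3 (a, b, c) x y" for x y
      using D p unfolding det3_comb by (metis prime_dvd_mult_iff prime_nat_int_transfer)
    from this[of "(0, 1, 0)" "(0, 0, 1)"] this[of "(0, 0, 1)" "(1, 0, 0)"]
      this[of "(1, 0, 0)" "(0, 1, 0)"]
    have "int p dvd a" "int p dvd b" "int p dvd c"
      by (simp_all add: det3_def)
    then show ?thesis
      using Q a b c by auto
  qed
  moreover have "{hpoint p u, hpoint p v, hpoint p w} \<subseteq> ground (PG2 p)"
    using nz PG2_ground by blast
  ultimately show "indep (PG2 p) {hpoint p u, hpoint p v, hpoint p w}"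
    unfolding PG2_def Let_def by simp
qed

lemma L_matroid_ground:
  assumes "prime p"
  shows "hpoint p (0, i, 1) \<in> ground (L_matroid p)" "hpoint p (1, i, 1) \<in> ground (L_matroid p)"
    "hpoint p (1, i, 0) \<in> ground (L_matroid p)" "hpoint p (0, 1, 0) \<in> ground (L_matroid p)"
    "x \<in> ground (L_matroid p) \<Longrightarrow> \<exists>j. x \<in> {hpoint p (0, j, 1), hpoint p (1, j, 1), hpoint p (1, j, 0),
      hpoint p (0, 1, 0)}"
proof -
  have one: "\<not> int p dvd 1"
    using assms by (metis prime_nat_int_transfer not_prime_unit)
  then have "\<not> zero_mod (int p) (0, i, 1)" "\<not> zero_mod (int p) (1, i, 1)"
    "\<not> zero_mod (int p) (1, i, 0)" "\<not> zero_mod (int p) (0, 1, 0)"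
    by simp_all
  then have g: "hpoint p (0, i, 1) \<in> ground (PG2 p)" "hpoint p (1, i, 1) \<in> ground (PG2 p)"
    "hpoint p (1, i, 0) \<in> ground (PG2 p)" "hpoint p (0, 1, 0) \<in> ground (PG2 p)"
    using PG2_ground by blast+
  have m: "i mod int p \<in> {0..<int p}"
    using prime_gt_0_nat[OF assms] by simp
  have "hom_point p a i b = hom_point p a (i mod int p) b" for a b
    by (rule hom_point_mod) (simp add: cong_def)
  then show "hpoint p (0, i, 1) \<in> ground (L_matroid p)" "hpoint p (1, i, 1) \<in> ground (L_matroid p)"
    "hpoint p (1, i, 0) \<in> ground (L_matroid p)" "hpoint p (0, 1, 0) \<in> ground (L_matroid p)"
    using g m unfolding L_matroid_def restriction_def by auto
  show "\<exists>j. x \<in> {hpoint p (0, j, 1), hpoint p (1, j, 1), hpoint p (1, j, 0), hpoint p (0, 1, 0)}"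
    if "x \<in> ground (L_matroid p)"
    using that unfolding L_matroid_def restriction_def by auto
qed

lemma L_matroid_net:
  assumes p: "prime p" and H: "harmonic_matroid M" and emb: "embedding (L_matroid p) M f"
  shows "harmonic_space.net (collinear3 M) (int p) (\<lambda>i. f (hpoint p (0, i, 1)))
    (\<lambda>i. f (hpoint p (1, i, 1))) (\<lambda>i. f (hpoint p (1, i, 0))) (f (hpoint p (0, 1, 0)))"
proof -
  interpret harmonic_space "ground M" "collinear3 M"
    by (rule harmonic_matroid_space[OF H])
  let ?N = "L_matroid p"
  have one: "\<not> int p dvd 1"
    using p by (metis prime_nat_int_transfer not_prime_unit)
  note g = L_matroid_ground(1-4)[OF p]
  have inj: "inj_on f (ground ?N)" and img: "f ` ground ?N \<subseteq> ground M"
    and ind: "indep ?N X \<longleftrightarrow> indep M (f ` X)" if "X \<subseteq> ground ?N" for X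
    using emb that unfolding embedding_def by blast+
  have f_eq: "f x = f y \<longleftrightarrow> x = y" if "x \<in> ground ?N" "y \<in> ground ?N" for x y
    using inj[of "{}"] that by (auto dest: inj_onD)
  have col: "collinear3 M (f x) (f y) (f z) \<longleftrightarrow> \<not> (distinct [x, y, z] \<and> indep (PG2 p) {x, y, z})"
    if xyz: "x \<in> ground ?N" "y \<in> ground ?N" "z \<in> ground ?N" for x y z
  proof -
    have "indep ?N {x, y, z} \<longleftrightarrow> indep (PG2 p) {x, y, z}"
      using xyz unfolding L_matroid_def restriction_def by auto
    moreover have "indep ?N {x, y, z} \<longleftrightarrow> indep M {f x, f y, f z}"
      using ind[of "{x, y, z}"] xyz by simp
    moreover have "{f x, f y, f z} \<subseteq> ground M"
      using img[of "{}"] xyz by auto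
    moreover have "distinct [f x, f y, f z] \<longleftrightarrow> distinct [x, y, z]"
      using f_eq xyz by simp
    ultimately show ?thesis
      unfolding collinear3_def by simp
  qed
  have dependent: "collinear3 M (f (hpoint p u)) (f (hpoint p v)) (f (hpoint p w))"
    if "hpoint p u \<in> ground ?N" "hpoint p v \<in> ground ?N" "hpoint p w \<in> ground ?N"
      "\<not> zero_mod (int p) w" "comb u v w (s, t, 1) = (0, 0, 0)" for u v w s t
    using PG2_dependent[of p u v w s t] that col by auto
  have independent: "\<not> collinear3 M (f (hpoint p u)) (f (hpoint p v)) (f (hpoint p w))"
    if "hpoint p u \<in> ground ?N" "hpoint p v \<in> ground ?N" "hpoint p w \<in> ground ?N"
      "\<not> int p dvd det3 u v w" for u v w
    using PG2_independent[OF p that(4)] that(1-3) col by simp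
  have eq: "hpoint p (a, i, b) = hpoint p (a, j, b) \<longleftrightarrow> [i = j] (mod int p)"
    if "(a, b) \<in> {(0, 1), (1, 1), (1, 0)}" for a b i j
  proof
    assume "hpoint p (a, i, b) = hpoint p (a, j, b)"
    then have "zero_mod (int p) (cross (a, i, b) (a, j, b))"
      by (rule hpoint_eqD)
    then show "[i = j] (mod int p)"
      using that by (auto simp: cong_iff_dvd_diff dvd_diff_commute)
  qed (simp add: hom_point_mod)
  show ?thesis
    unfolding net_def
  proof (intro conjI allI)
    fix i j
    show "collinear3 M (f (hpoint p (0, 1, 0))) (f (hpoint p (0, i, 1))) (f (hpoint p (0, j, 1)))"
      by (rule dependent[of "(0, 1, 0)" "(0, i, 1)" "(0, j, 1)" "i - j" "- 1"])
        (use g one in simp_all)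
    show "collinear3 M (f (hpoint p (0, 1, 0))) (f (hpoint p (1, i, 1))) (f (hpoint p (1, j, 1)))"
      by (rule dependent[of "(0, 1, 0)" "(1, i, 1)" "(1, j, 1)" "i - j" "- 1"])
        (use g one in simp_all)
    show "collinear3 M (f (hpoint p (0, 1, 0))) (f (hpoint p (1, i, 0))) (f (hpoint p (1, j, 0)))"
      by (rule dependent[of "(0, 1, 0)" "(1, i, 0)" "(1, j, 0)" "i - j" "- 1"])
        (use g one in simp_all)
    show "\<not> collinear3 M (f (hpoint p (0, 1, 0))) (f (hpoint p (0, i, 1))) (f (hpoint p (1, j, 1)))"
      by (rule independent[OF g(4) g(1) g(2)]) (use one in \<open>simp add: det3_def\<close>)
    show "\<not> collinear3 M (f (hpoint p (0, 1, 0))) (f (hpoint p (0, i, 1))) (f (hpoint p (1, j, 0)))"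
      by (rule independent[OF g(4) g(1) g(3)]) (use one in \<open>simp add: det3_def\<close>)
    show "\<not> collinear3 M (f (hpoint p (0, 1, 0))) (f (hpoint p (1, i, 1))) (f (hpoint p (1, j, 0)))"
      by (rule independent[OF g(4) g(2) g(3)]) (use one in \<open>simp add: det3_def\<close>)
    show "f (hpoint p (0, i, 1)) = f (hpoint p (0, j, 1)) \<longleftrightarrow> [i = j] (mod int p)"
      unfolding f_eq[OF g(1) g(1)] by (rule eq) simp
    show "f (hpoint p (1, i, 1)) = f (hpoint p (1, j, 1)) \<longleftrightarrow> [i = j] (mod int p)"
      unfolding f_eq[OF g(2) g(2)] by (rule eq) simp
    show "f (hpoint p (1, i, 0)) = f (hpoint p (1, j, 0)) \<longleftrightarrow> [i = j] (mod int p)"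
      unfolding f_eq[OF g(3) g(3)] by (rule eq) simp
    show "collinear3 M (f (hpoint p (0, i, 1))) (f (hpoint p (1, i + j, 1))) (f (hpoint p (1, j, 0)))"
      by (rule dependent[of "(0, i, 1)" "(1, i + j, 1)" "(1, j, 0)" 1 "- 1"])
        (use g one in simp_all)
  qed
qed

section \<open>The plane generated by \<open>L\<^sub>p\<close>\<close>

theorem theorem4p2:
  fixes p :: nat and M :: "'a matroid_struct"
    and f :: "(int \<times> int \<times> int) set \<Rightarrow> 'a"
  assumes "prime p"
    and "harmonic_matroid M"
    and "embedding (L_matroid p) M f"
  shows "desarguesian_plane_in M (harmonic_closure M (f ` ground (L_matroid p))) p"
proof -
  have M: "simple_matroid M"
    using assms(2) unfolding harmonic_matroid_def by blast
  have prime: "prime (int p)"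
    using assms(1) by simp
  then have p1: "int p > 1"
    by (rule prime_gt_1_int)
  interpret harmonic_space "ground M" "collinear3 M"
    by (rule harmonic_matroid_space[OF assms(2)])
  let ?S = "f ` ground (L_matroid p)"
  let ?H = "harmonic_closure M ?S"
  define A B D c where "A i = f (hpoint p (0, i, 1))" and "B i = f (hpoint p (1, i, 1))"
    and "D i = f (hpoint p (1, i, 0))" and "c = f (hpoint p (0, 1, 0))" for i
  have N: "net (int p) A B D c"
    using L_matroid_net[OF assms] unfolding A_def B_def D_def c_def .
  have S: "A i \<in> ?S" "B i \<in> ?S" "D i \<in> ?S" "c \<in> ?S" for i
    using L_matroid_ground(1-4)[OF assms(1)] unfolding A_def B_def D_def c_def by blast+
  obtain P where P: "P 0 = A" "P 1 = B" "\<And>n. net (int p) (P n) (P (Suc n)) D c"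
    "\<And>n k. hconj (P (Suc n) k) (D 0) (P n k) (P (Suc (Suc n)) k)"
    using net_sequence[OF N p1] by metis
  interpret co: coordinatized "ground M" "collinear3 M" "int p" "\<lambda>x. P (nat (x mod int p))" D c
    by (rule net_coordinates[OF N prime P(1,3)])
  interpret pl: coordinate_plane "ground M" "collinear3 M" "int p" co.pt
    by unfold_locales
      (use prime co.pt_in co.pt_eq_iff co.col_pt co.not_col_pt in blast)+
  have SH: "?S \<subseteq> ?H"
    by (rule harmonic_closure_base)
  have PH: "P n k \<in> ?H \<and> P (Suc n) k \<in> ?H" for n k
  proof (induction n)
    case 0
    then show ?case using S P(1,2) SH by auto
  next
    case (Suc n)
    then show ?case
      using harmonic_closure_closed[OF _ _ _ hconj_harmonic_conj[OF assms(2) P(4)[of n k]]] S SH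
      by blast
  qed
  (* Every point of the plane arises from the net by repeated harmonic conjugation. *)
  have "pl.plane \<subseteq> ?H"
  proof
    fix x assume "x \<in> pl.plane"
    then obtain a b d where "x = co.pt (a, b, d)"
      unfolding pl.plane_def by auto
    then show "x \<in> ?H"
      using PH S SH by auto
  qed
  (* The conjugate can be computed from a quadrangle inside the plane. *)
  moreover have "?H \<subseteq> pl.plane"
  proof (rule harmonic_closure_least)
    note one = pl.not_dvd_one
    have "A i = co.pt (0, i, 1)" "B i = co.pt (1, i, 1)" "D i = co.pt (1, i, 0)" "c = co.pt (0, 1, 0)"
      for i
      using P(1,2) p1 by (simp_all only: co.pt_affine co.pt_infinite co.pt_vertical) simp_all
    moreover have "co.pt (0, i, 1) \<in> pl.plane" "co.pt (1, i, 1) \<in> pl.plane"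
      "co.pt (1, i, 0) \<in> pl.plane" "co.pt (0, 1, 0) \<in> pl.plane" for i
      by (rule pl.pt_plane; use one in simp)+
    ultimately have "A i \<in> pl.plane" "B i \<in> pl.plane" "D i \<in> pl.plane" "c \<in> pl.plane" for i
      by (simp_all only:)
    then show "?S \<subseteq> pl.plane"
      using L_matroid_ground(5)[OF assms(1)] unfolding A_def B_def D_def c_def by blast
  next
    fix a b e x
    assume abe: "a \<in> pl.plane" "b \<in> pl.plane" "e \<in> pl.plane" and x: "harmonic_conj M a e b x"
    obtain o' q r s where "HP M a b e o' q r s"
      using x unfolding harmonic_conj_def by blast
    then have "distinct [a, b, e]" "collinear3 M a b e"
      using HP_line[OF M] by blast+
    then obtain o' q r s x' where Q: "quad a b e o' q r s" "x' \<in> pl.plane" "collinear3 M a e x'"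
      "collinear3 M o' r x'"
      using pl.fourth_harmonic[OF abe] by metis
    then have "harmonic_conj M a e b x'"
      using hconj_harmonic_conj[OF assms(2)] unfolding hconj_def by blast
    then have "x = x'"
      using x assms(2) unfolding harmonic_matroid_def by blast
    then show "x \<in> pl.plane"
      using Q(2) by simp
  qed
  ultimately have "?H = pl.plane" by blast
  moreover have "lines (restriction M pl.plane) = pl.plane_lines"
    using lines_restriction_iff[OF M pl.plane_pts] unfolding pl.plane_lines_def pl.line_def by blast
  ultimately show ?thesis
    unfolding desarguesian_plane_in_def
    using pl.plane_pts pl.plane_projective pl.plane_order pl.plane_desarguesian by simp
qed

end
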